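(* Let $A$ be a positive self-adjoint operator on $L^2(X,H)$. Let $\Pi_\lambda$ denote either $\Pi_{]0,\lambda]}=\chi_A(]0,\lambda])$ for all $\lambda$, or $\Pi_{[0,\lambda]}=\chi_A([0,\lambda])$ for all $\lambda$. Put $F(\lambda)=D(\Pi_\lambda)$, assumed finite for all $\lambda$, and $F_\Omega(\lambda)=\tau(\chi_\Omega\Pi_\lambda\chi_\Omega)=\nu_{\Pi_\lambda}(\Omega)$ for measurable $\Omega\subset X$. (1) Let $\rho$ be a non-zero positive operator, with $\rho=0$ on $\ker A$ if $\Pi_{]0,\lambda]}$ is used. Suppose that $\rho$ is supported in a domain $\Omega$ of finite measure and has finite energy $\mathcal{E}(\rho)$. Then $$\frac{\tau(\rho)}{4\,\|\rho\|_{2,2}}\le F_\Omega\bigl(4\langle A\rangle_\rho\bigr)\le\mu(\Omega)\,F\bigl(4\langle A\rangle_\rho\bigr),$$ where $\langle A\rangle_\rho=\frac{\mathcal{E}(\rho)}{\tau(\rho)}=\frac{\tau(A\rho)}{\tau(\rho)}$ is the expectation value of $A$ with respect to $\rho$. (2) In particular, for every $\Omega$ of finite measure and all $\lambda$, $$F_\Omega^{\dim}(\lambda)\le 4\,\mu(\Omega)\,F(4\lambda),$$ where $F_\Omega^{\dim}(\lambda)=\sup\{\dim V\mid \operatorname{supp}(V)\subset\Omega\text{ and }\mathcal{E}\le\lambda\text{ on }V\}$ (with $V$ moreover orthogonal to $\ker A$ if $\Pi_{]0,\lambda]}$ is used).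
   Context: $(X,\mu)$ is a $\sigma$-finite measure space and $H$ a separable Hilbert space. $A$ is a possibly unbounded non-negative self-adjoint operator; $\rho$ is a bounded non-negative self-adjoint operator, with $L^2$ operator norm $\|\rho\|_{2,2}$. $\chi_A(I)$ is the spectral projection of $A$ on $I$, and $]0,\lambda]=(0,\lambda]$. For a positive operator $P$ and measurable $\Omega\subset X$, $\nu_P(\Omega)=\tau(\chi_\Omega P\chi_\Omega)=\tau(P^{1/2}\chi_\Omega P^{1/2})\in[0,+\infty]$, where $\tau$ is the trace of positive operators and $\chi_\Omega$ is multiplication by the indicator of $\Omega$; this is a measure absolutely continuous with respect to $\mu$, $D\nu_P=\frac{d\nu_P}{d\mu}$, and $D(P)=\|D\nu_P\|_\infty$ is the density of $P$. The energy is $\mathcal{E}(\rho)=\tau(\rho^{1/2}A\rho^{1/2})=\|A^{1/2}\rho^{1/2}\|_{HS}^2$. "$\rho$ is supported in $\Omega$" means $\rho=\chi_\Omega\rho\chi_\Omega$. In (2), $V$ ranges over finite-dimensional linear subspaces of $L^2(X,H)$ of functions vanishing a.e. outside $\Omega$, and "$\mathcal{E}\le\lambda$ on $V$" means $\mathcal{E}(f)=\|A^{1/2}f\|_2^2\le\lambda\|f\|_2^2$ for all $f\in V$. *)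

theory Defs
  imports "HOL-Analysis.Analysis" "HOL-Probability.Essential_Supremum"
begin

section \<open>Complex inner product spaces\<close>

text \<open>The inner product is conjugate-linear in its first argument. Norm, metric and topology are
  those of the underlying real inner product space, whose inner product is the real part.\<close>

class complex_inner = real_inner +
  fixes scaleC :: "complex \<Rightarrow> 'a \<Rightarrow> 'a"  (infixr "*\<^sub>C" 75)
    and cinner :: "'a \<Rightarrow> 'a \<Rightarrow> complex"
  assumes scaleC_add_right: "a *\<^sub>C (x + y) = a *\<^sub>C x + a *\<^sub>C y"
    and scaleC_add_left: "(a + b) *\<^sub>C x = a *\<^sub>C x + b *\<^sub>C x"
    and scaleC_scaleC: "a *\<^sub>C b *\<^sub>C x = (a * b) *\<^sub>C x"
    and scaleR_scaleC: "r *\<^sub>R x = complex_of_real r *\<^sub>C x"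
    and cinner_commute: "cinner x y = cnj (cinner y x)"
    and cinner_add_right: "cinner x (y + z) = cinner x y + cinner x z"
    and cinner_scaleC_right: "cinner x (a *\<^sub>C y) = a * cinner x y"
    and inner_eq_Re_cinner: "inner x y = Re (cinner x y)"

class separable_hilbert = complex_inner + complete_space + second_countable_topology

interpretation complex_vector: vector_space "scaleC :: complex \<Rightarrow> 'a \<Rightarrow> 'a::complex_inner"
proof
  show "1 *\<^sub>C x = x" for x :: 'a
    using scaleR_scaleC[of 1 x] by simp
qed (simp_all add: scaleC_add_right scaleC_add_left scaleC_scaleC)

lemma cinner_scaleC_left: "cinner (a *\<^sub>C x) y = cnj a * cinner x y"
  by (metis cinner_commute cinner_scaleC_right complex_cnj_mult)

lemma cinner_add_left: "cinner (x + y) z = cinner x z + cinner y z"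
  by (metis cinner_commute cinner_add_right complex_cnj_add)

lemma cinner_eq_Complex: "cinner x y = Complex (inner x y) (inner (\<i> *\<^sub>C x) y)"
  by (simp add: complex_eq_iff inner_eq_Re_cinner cinner_scaleC_left)

lemma inner_scaleC_scaleC: "inner (a *\<^sub>C x) (a *\<^sub>C y) = (cmod a)\<^sup>2 * inner x y"
proof -
  have "cinner (a *\<^sub>C x) (a *\<^sub>C y) = (a * cnj a) * cinner x y"
    by (simp add: cinner_scaleC_left cinner_scaleC_right)
  then show ?thesis
    by (simp add: inner_eq_Re_cinner complex_norm_square[symmetric] del: of_real_power)
qed

lemma norm_scaleC: "norm (a *\<^sub>C x) = cmod a * norm (x::'a::complex_inner)"
  by (simp add: norm_eq_sqrt_inner inner_scaleC_scaleC real_sqrt_mult)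

lemma bounded_linear_scaleC: "bounded_linear (\<lambda>x::'a::complex_inner. a *\<^sub>C x)"
proof (rule bounded_linear_intro[where K = "cmod a"])
  show "a *\<^sub>C r *\<^sub>R x = r *\<^sub>R a *\<^sub>C x" for r and x :: 'a
    by (simp add: scaleR_scaleC scaleC_scaleC mult.commute)
qed (simp_all add: scaleC_add_right norm_scaleC mult.commute)

lemma borel_measurable_scaleC:
  "f \<in> borel_measurable M \<Longrightarrow> (\<lambda>x. a *\<^sub>C f x :: 'a::complex_inner) \<in> borel_measurable M"
  by (rule measurable_compose[where N = borel])
     (auto intro!: borel_measurable_continuous_onI linear_continuous_on bounded_linear_scaleC)

section \<open>The Hilbert space of square-integrable functions\<close>

text \<open>The measure space \<open>(X, \<mu>)\<close> is attached to its underlying type, so that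
  \<open>L\<^sup>2(X, H)\<close> is a type. The space of the measure need not be all of the type.\<close>

class sigma_finite_space =
  fixes base_measure :: "'a measure"  ("\<mu>")
  assumes sigma_finite_base_measure: "sigma_finite_measure base_measure"

definition square_integrable :: "('x::sigma_finite_space \<Rightarrow> 'h::separable_hilbert) \<Rightarrow> bool" where
  "square_integrable f \<longleftrightarrow> f \<in> borel_measurable \<mu> \<and> integrable \<mu> (\<lambda>x. (norm (f x))\<^sup>2)"

lemma square_integrable_zero: "square_integrable (\<lambda>_. 0)"
  by (simp add: square_integrable_def)

lemma square_integrable_bound:
  assumes "f \<in> borel_measurable \<mu>" "integrable \<mu> g" "\<And>x. (norm (f x))\<^sup>2 \<le> g x"
  shows "square_integrable f"
  unfolding square_integrable_def
proof
  show "integrable \<mu> (\<lambda>x. (norm (f x))\<^sup>2)"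
  proof (rule Bochner_Integration.integrable_bound[OF assms(2)])
    show "AE x in \<mu>. norm ((norm (f x))\<^sup>2) \<le> norm (g x)"
      using assms(3) by (auto intro!: AE_I2 intro: order_trans[OF _ abs_ge_self])
  qed (use assms(1) in measurable)
qed (fact assms(1))

lemma norm_add_power2_le: "(norm (x + y))\<^sup>2 \<le> 2 * (norm x)\<^sup>2 + 2 * (norm (y::'a::real_inner))\<^sup>2"
  using zero_le_power2[of "norm (x - y)"]
  by (simp add: power2_norm_eq_inner inner_add_left inner_add_right inner_diff_left inner_diff_right
      inner_commute)

lemma square_integrable_add:
  assumes "square_integrable f" "square_integrable g"
  shows "square_integrable (\<lambda>x. f x + g x)"
  using assms norm_add_power2_le
  by (intro square_integrable_bound[where g = "\<lambda>x. 2 * (norm (f x))\<^sup>2 + 2 * (norm (g x))\<^sup>2"])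
     (auto simp: square_integrable_def)

lemma square_integrable_scaleC:
  assumes "square_integrable f"
  shows "square_integrable (\<lambda>x. c *\<^sub>C f x)"
proof (rule square_integrable_bound[where g = "\<lambda>x. (cmod c)\<^sup>2 * (norm (f x))\<^sup>2"])
  show "(\<lambda>x. c *\<^sub>C f x) \<in> borel_measurable \<mu>"
    using assms by (simp add: square_integrable_def borel_measurable_scaleC)
qed (use assms in \<open>auto simp: square_integrable_def norm_scaleC power_mult_distrib\<close>)

lemma square_integrable_scaleR:
  "square_integrable f \<Longrightarrow> square_integrable (\<lambda>x. c *\<^sub>R f x)"
  by (simp add: scaleR_scaleC square_integrable_scaleC)

lemma square_integrable_uminus: "square_integrable f \<Longrightarrow> square_integrable (\<lambda>x. - f x)"
  using square_integrable_scaleR[of f "-1"] by simp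

lemma square_integrable_diff:
  "square_integrable f \<Longrightarrow> square_integrable g \<Longrightarrow> square_integrable (\<lambda>x. f x - g x)"
  using square_integrable_add[of f "\<lambda>x. - g x"] square_integrable_uminus[of g] by simp

lemma borel_measurable_cinner:
  assumes "f \<in> borel_measurable M" "g \<in> borel_measurable M"
  shows "(\<lambda>x. cinner (f x) (g x :: 'h::separable_hilbert)) \<in> borel_measurable M"
proof -
  have "(\<lambda>x. \<i> *\<^sub>C f x) \<in> borel_measurable M"
    using assms(1) by (rule borel_measurable_scaleC)
  then show ?thesis
    using assms unfolding cinner_eq_Complex borel_measurable_complex_iff by simp
qed

lemma norm_cinner_le: "cmod (cinner x y) \<le> (norm x)\<^sup>2 + (norm (y::'a::complex_inner))\<^sup>2"
proof -
  have *: "\<bar>inner u v\<bar> \<le> ((norm u)\<^sup>2 + (norm v)\<^sup>2) / 2" for u v :: 'a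
  proof -
    have "0 \<le> (norm u - norm v)\<^sup>2" by simp
    then show ?thesis
      using Cauchy_Schwarz_ineq2[of u v] by (simp add: power2_diff)
  qed
  have "cmod (cinner x y) \<le> \<bar>inner x y\<bar> + \<bar>inner (\<i> *\<^sub>C x) y\<bar>"
    unfolding cinner_eq_Complex by (rule order_trans[OF cmod_le]) simp
  also have "\<dots> \<le> (norm x)\<^sup>2 + (norm y)\<^sup>2"
    using *[of x y] *[of "\<i> *\<^sub>C x" y] by (simp add: norm_scaleC)
  finally show ?thesis .
qed

lemma integrable_cinner:
  assumes "square_integrable f" "square_integrable g"
  shows "integrable \<mu> (\<lambda>x. cinner (f x) (g x))"
proof (rule Bochner_Integration.integrable_bound)
  show "integrable \<mu> (\<lambda>x. (norm (f x))\<^sup>2 + (norm (g x))\<^sup>2)"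
    using assms by (simp add: square_integrable_def)
  show "(\<lambda>x. cinner (f x) (g x)) \<in> borel_measurable \<mu>"
    using assms by (simp add: square_integrable_def borel_measurable_cinner)
  show "AE x in \<mu>. cmod (cinner (f x) (g x)) \<le> norm ((norm (f x))\<^sup>2 + (norm (g x))\<^sup>2)"
    by (intro AE_I2) (simp add: order_trans[OF norm_cinner_le])
qed

quotient_type (overloaded) ('x, 'h) L2 =
  "'x::sigma_finite_space \<Rightarrow> 'h::separable_hilbert" / partial:
  "\<lambda>f g. square_integrable f \<and> square_integrable g \<and> (AE x in \<mu>. f x = g x)"
proof (rule part_equivpI)
  show "\<exists>f::'x \<Rightarrow> 'h. square_integrable f \<and> square_integrable f \<and> (AE x in \<mu>. f x = f x)"
    using square_integrable_zero by auto
qed (auto intro!: sympI transpI)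

instantiation L2 :: (sigma_finite_space, separable_hilbert) complex_inner
begin

lift_definition zero_L2 :: "('a, 'b) L2" is "\<lambda>_. 0"
  by (simp add: square_integrable_zero)

lift_definition plus_L2 :: "('a, 'b) L2 \<Rightarrow> ('a, 'b) L2 \<Rightarrow> ('a, 'b) L2" is "\<lambda>f g x. f x + g x"
  by (auto intro: square_integrable_add)

lift_definition uminus_L2 :: "('a, 'b) L2 \<Rightarrow> ('a, 'b) L2" is "\<lambda>f x. - f x"
  by (auto intro: square_integrable_uminus)

lift_definition minus_L2 :: "('a, 'b) L2 \<Rightarrow> ('a, 'b) L2 \<Rightarrow> ('a, 'b) L2" is "\<lambda>f g x. f x - g x"
  by (auto intro: square_integrable_diff)

lift_definition scaleR_L2 :: "real \<Rightarrow> ('a, 'b) L2 \<Rightarrow> ('a, 'b) L2" is "\<lambda>c f x. c *\<^sub>R f x"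
  by (auto intro: square_integrable_scaleR)

lift_definition scaleC_L2 :: "complex \<Rightarrow> ('a, 'b) L2 \<Rightarrow> ('a, 'b) L2" is "\<lambda>c f x. c *\<^sub>C f x"
  by (auto intro: square_integrable_scaleC)

lift_definition cinner_L2 :: "('a, 'b) L2 \<Rightarrow> ('a, 'b) L2 \<Rightarrow> complex"
  is "\<lambda>f g. \<integral>x. cinner (f x) (g x) \<partial>\<mu>"
  by (intro integral_cong_AE) (auto simp: square_integrable_def intro: borel_measurable_cinner)

definition "inner f (g :: ('a, 'b) L2) = Re (cinner f g)"
definition "norm (f :: ('a, 'b) L2) = sqrt (inner f f)"
definition "sgn (f :: ('a, 'b) L2) = inverse (norm f) *\<^sub>R f"
definition "dist (f :: ('a, 'b) L2) g = norm (f - g)"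
definition "(uniformity :: (('a, 'b) L2 \<times> ('a, 'b) L2) filter) =
  (INF e\<in>{0<..}. principal {(f, g). dist f g < e})"
definition "open (U :: ('a, 'b) L2 set) \<longleftrightarrow>
  (\<forall>f\<in>U. eventually (\<lambda>(f', g). f' = f \<longrightarrow> g \<in> U) uniformity)"

instance
proof
  fix f g h :: "('a, 'b) L2" and a b :: complex and r s :: real
  have commute: "cinner f g = cnj (cinner g f)" for f g :: "('a, 'b) L2"
    by transfer (simp add: Bochner_Integration.integral_cnj[symmetric] cinner_commute[symmetric])
  have add: "cinner f (g + h) = cinner f g + cinner f h" for f g h :: "('a, 'b) L2"
    by transfer (simp add: cinner_add_right integrable_cinner)
  have scale: "cinner f (a *\<^sub>C g) = a * cinner f g" for f g :: "('a, 'b) L2" and a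
    by transfer (simp add: cinner_scaleC_right)
  have scaleR: "r *\<^sub>R f = complex_of_real r *\<^sub>C f" for f :: "('a, 'b) L2" and r
    by transfer (auto simp: scaleR_scaleC intro: square_integrable_scaleC)
  have inner_commute': "inner f g = inner g f" for f g :: "('a, 'b) L2"
    unfolding inner_L2_def using commute[of f g] by simp
  show "f + g + h = f + (g + h)"
    by transfer (auto simp: add.assoc intro: square_integrable_add)
  show "f + g = g + f"
    by transfer (auto simp: add.commute intro: square_integrable_add)
  show "0 + f = f" by transfer simp
  show "- f + f = 0" by transfer (simp add: square_integrable_zero)
  show "f - g = f + - g" by transfer (auto intro: square_integrable_diff)
  show "r *\<^sub>R (f + g) = r *\<^sub>R f + r *\<^sub>R g"
    by transfer (auto simp: scaleR_add_right intro: square_integrable_add square_integrable_scaleR)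
  show "(r + s) *\<^sub>R f = r *\<^sub>R f + s *\<^sub>R f"
    by transfer (auto simp: scaleR_add_left intro: square_integrable_add square_integrable_scaleR)
  show "r *\<^sub>R s *\<^sub>R f = (r * s) *\<^sub>R f"
    by transfer (auto intro: square_integrable_scaleR)
  show "1 *\<^sub>R f = f" by transfer simp
  show "sgn f = inverse (norm f) *\<^sub>R f" by (fact sgn_L2_def)
  show "dist f g = norm (f - g)" by (fact dist_L2_def)
  show "(uniformity :: (('a, 'b) L2 \<times> ('a, 'b) L2) filter) =
      (INF e\<in>{0<..}. principal {(f, g). dist f g < e})"
    by (fact uniformity_L2_def)
  show "open U \<longleftrightarrow> (\<forall>f\<in>U. \<forall>\<^sub>F (f', g) in uniformity. f' = f \<longrightarrow> g \<in> U)" for U :: "('a, 'b) L2 set"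
    by (fact open_L2_def)
  show "inner f g = inner g f" by (fact inner_commute')
  show "inner (f + g) h = inner f h + inner g h"
    unfolding inner_commute'[of _ h] by (simp add: inner_L2_def add)
  show "inner (r *\<^sub>R f) g = r * inner f g"
    unfolding inner_commute'[of _ g] by (simp add: inner_L2_def scaleR scale)
  have inner_self: "inner f f = Re (cinner f f)" for f :: "('a, 'b) L2"
    by (fact inner_L2_def)
  show "0 \<le> inner f f"
    unfolding inner_L2_def
  proof transfer
    fix f :: "'a \<Rightarrow> 'b"
    assume "square_integrable f \<and> square_integrable f \<and> (AE x in \<mu>. f x = f x)"
    then show "0 \<le> Re (\<integral>x. cinner (f x) (f x) \<partial>\<mu>)"
      by (simp add: integral_Re[symmetric] integrable_cinner inner_eq_Re_cinner[symmetric])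
  qed
  show "inner f f = 0 \<longleftrightarrow> f = 0"
    unfolding inner_L2_def
  proof transfer
    fix f :: "'a \<Rightarrow> 'b"
    assume f: "square_integrable f \<and> square_integrable f \<and> (AE x in \<mu>. f x = f x)"
    then have int: "integrable \<mu> (\<lambda>x. (norm (f x))\<^sup>2)"
      by (simp add: square_integrable_def)
    have "Re (\<integral>x. cinner (f x) (f x) \<partial>\<mu>) = (\<integral>x. (norm (f x))\<^sup>2 \<partial>\<mu>)"
      using f by (simp add: integral_Re[symmetric] integrable_cinner inner_eq_Re_cinner[symmetric]
          power2_norm_eq_inner)
    then show "Re (\<integral>x. cinner (f x) (f x) \<partial>\<mu>) = 0 \<longleftrightarrow>
        square_integrable f \<and> square_integrable (\<lambda>_. 0 :: 'b) \<and> (AE x in \<mu>. f x = 0)"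
      using f integral_nonneg_eq_0_iff_AE[OF int] by (simp add: square_integrable_zero)
  qed
  show "norm f = sqrt (inner f f)" by (fact norm_L2_def)
  show "a *\<^sub>C (f + g) = a *\<^sub>C f + a *\<^sub>C g"
    by transfer (auto simp: scaleC_add_right intro: square_integrable_add square_integrable_scaleC)
  show "(a + b) *\<^sub>C f = a *\<^sub>C f + b *\<^sub>C f"
    by transfer (auto simp: scaleC_add_left intro: square_integrable_add square_integrable_scaleC)
  show "a *\<^sub>C b *\<^sub>C f = (a * b) *\<^sub>C f"
    by transfer (auto simp: scaleC_scaleC intro: square_integrable_scaleC)
  show "r *\<^sub>R f = complex_of_real r *\<^sub>C f" by (fact scaleR)
  show "cinner f g = cnj (cinner g f)" by (fact commute)
  show "cinner f (g + h) = cinner f g + cinner f h" by (fact add)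
  show "cinner f (a *\<^sub>C g) = a * cinner f g" by (fact scale)
  show "inner f g = Re (cinner f g)" by (fact inner_L2_def)
qed

end

text \<open>Multiplication by the indicator function of \<open>\<Omega>\<close>. It is only used for measurable \<open>\<Omega>\<close>; for other
  sets it is set to \<open>0\<close>.\<close>

lift_definition chi :: "'x set \<Rightarrow> ('x::sigma_finite_space, 'h::separable_hilbert) L2 \<Rightarrow> ('x, 'h) L2"
  is "\<lambda>\<Omega> f x. if \<Omega> \<in> sets \<mu> \<and> x \<in> \<Omega> then f x else 0"
proof -
  fix \<Omega> :: "'x set" and f g :: "'x \<Rightarrow> 'h"
  have *: "square_integrable (\<lambda>x. if \<Omega> \<in> sets \<mu> \<and> x \<in> \<Omega> then f x else 0)"
    if f: "square_integrable f" for f :: "'x \<Rightarrow> 'h"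
  proof (rule square_integrable_bound[where g = "\<lambda>x. (norm (f x))\<^sup>2"])
    show "(\<lambda>x. if \<Omega> \<in> sets \<mu> \<and> x \<in> \<Omega> then f x else 0) \<in> borel_measurable \<mu>"
      using f by (cases "\<Omega> \<in> sets \<mu>") (auto simp: square_integrable_def)
  qed (use f in \<open>auto simp: square_integrable_def\<close>)
  assume "square_integrable f \<and> square_integrable g \<and> (AE x in \<mu>. f x = g x)"
  then show "square_integrable (\<lambda>x. if \<Omega> \<in> sets \<mu> \<and> x \<in> \<Omega> then f x else 0) \<and>
      square_integrable (\<lambda>x. if \<Omega> \<in> sets \<mu> \<and> x \<in> \<Omega> then g x else 0) \<and>
      (AE x in \<mu>. (if \<Omega> \<in> sets \<mu> \<and> x \<in> \<Omega> then f x else 0) =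
                 (if \<Omega> \<in> sets \<mu> \<and> x \<in> \<Omega> then g x else 0))"
    by (auto intro: *)
qed

lift_definition vanishes_outside ::
  "'x set \<Rightarrow> ('x::sigma_finite_space, 'h::separable_hilbert) L2 \<Rightarrow> bool"
  is "\<lambda>\<Omega> f. AE x in \<mu>. x \<notin> \<Omega> \<longrightarrow> f x = 0"
proof -
  fix \<Omega> :: "'x set" and f g :: "'x \<Rightarrow> 'h"
  assume "square_integrable f \<and> square_integrable g \<and> (AE x in \<mu>. f x = g x)"
  then have "AE x in \<mu>. f x = g x" by simp
  then show "(AE x in \<mu>. x \<notin> \<Omega> \<longrightarrow> f x = 0) = (AE x in \<mu>. x \<notin> \<Omega> \<longrightarrow> g x = 0)"
    by (intro eventually_subst) (auto elim: eventually_mono)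
qed

section \<open>Bounded and unbounded operators\<close>

text \<open>An unbounded operator is given by its domain \<open>D\<close> and a function \<open>A\<close>, whose values outside \<open>D\<close>
  are irrelevant.\<close>

definition linear_operator :: "'a::complex_inner set \<Rightarrow> ('a \<Rightarrow> 'a) \<Rightarrow> bool" where
  "linear_operator D A \<longleftrightarrow> complex_vector.subspace D \<and>
     (\<forall>f\<in>D. \<forall>g\<in>D. A (f + g) = A f + A g) \<and> (\<forall>c. \<forall>f\<in>D. A (c *\<^sub>C f) = c *\<^sub>C A f)"

text \<open>The last condition says that the graph of the adjoint of \<open>A\<close> is the graph of \<open>A\<close>.\<close>

definition self_adjoint :: "'a::complex_inner set \<Rightarrow> ('a \<Rightarrow> 'a) \<Rightarrow> bool" where
  "self_adjoint D A \<longleftrightarrow> linear_operator D A \<and> closure D = UNIV \<and>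
     (\<forall>g h. (\<forall>f\<in>D. cinner (A f) g = cinner f h) \<longleftrightarrow> g \<in> D \<and> A g = h)"

definition positive_self_adjoint :: "'a::complex_inner set \<Rightarrow> ('a \<Rightarrow> 'a) \<Rightarrow> bool" where
  "positive_self_adjoint D A \<longleftrightarrow> self_adjoint D A \<and> (\<forall>f\<in>D. 0 \<le> Re (cinner f (A f)))"

definition null_space :: "'a::complex_inner set \<Rightarrow> ('a \<Rightarrow> 'a) \<Rightarrow> 'a set" where
  "null_space D A = {f\<in>D. A f = 0}"

definition positive_bounded :: "('a::complex_inner \<Rightarrow> 'a) \<Rightarrow> bool" where
  "positive_bounded P \<longleftrightarrow> bounded_linear P \<and> positive_self_adjoint UNIV P"

definition sqrt_op :: "('a::complex_inner \<Rightarrow> 'a) \<Rightarrow> 'a \<Rightarrow> 'a" where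
  "sqrt_op P = (THE S. positive_bounded S \<and> S \<circ> S = P)"

definition orthogonal_projection :: "('a::complex_inner \<Rightarrow> 'a) \<Rightarrow> bool" where
  "orthogonal_projection P \<longleftrightarrow> bounded_linear P \<and> self_adjoint UNIV P \<and> P \<circ> P = P"

definition orthonormal_basis :: "'a::complex_inner set \<Rightarrow> bool" where
  "orthonormal_basis B \<longleftrightarrow> (\<forall>e\<in>B. norm e = 1) \<and> (\<forall>e\<in>B. \<forall>e'\<in>B. e \<noteq> e' \<longrightarrow> cinner e e' = 0) \<and>
     closure (complex_vector.span B) = UNIV"

text \<open>The trace of a positive operator and the Hilbert-Schmidt norm do not depend on the orthonormal
  basis. The basis is not assumed countable, since \<open>L\<^sup>2(X, H)\<close> need not be separable.\<close>

definition some_basis :: "'a::complex_inner set" where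
  "some_basis = (SOME B. orthonormal_basis B)"

definition op_trace :: "('a::complex_inner \<Rightarrow> 'a) \<Rightarrow> ennreal" where
  "op_trace P = (\<Sum>\<^sub>\<infinity>e\<in>some_basis. ennreal (Re (cinner e (P e))))"

section \<open>Spectral measures and functional calculus\<close>

definition projection_valued_measure :: "(real set \<Rightarrow> 'a::complex_inner \<Rightarrow> 'a) \<Rightarrow> bool" where
  "projection_valued_measure E \<longleftrightarrow>
     (\<forall>B\<in>sets borel. orthogonal_projection (E B)) \<and>
     E {} = (\<lambda>_. 0) \<and> E UNIV = id \<and>
     (\<forall>B\<in>sets borel. \<forall>C\<in>sets borel. E (B \<inter> C) = E B \<circ> E C) \<and>
     (\<forall>B. range B \<subseteq> sets borel \<and> disjoint_family B \<longrightarrow>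
        (\<forall>f. (\<lambda>n. E (B n) f) sums E (\<Union>n. B n) f))"

definition scalar_measure :: "(real set \<Rightarrow> 'a::complex_inner \<Rightarrow> 'a) \<Rightarrow> 'a \<Rightarrow> real measure" where
  "scalar_measure E f = measure_of UNIV (sets borel) (\<lambda>B. ennreal (Re (cinner f (E B f))))"

definition fcalc_dom :: "(real set \<Rightarrow> 'a::complex_inner \<Rightarrow> 'a) \<Rightarrow> (real \<Rightarrow> real) \<Rightarrow> 'a set" where
  "fcalc_dom E \<phi> = {f. (\<integral>\<^sup>+ t. ennreal ((\<phi> t)\<^sup>2) \<partial>scalar_measure E f) < \<infinity>}"

text \<open>The operator \<open>\<integral> \<phi> dE\<close>, with domain \<open>fcalc_dom E \<phi>\<close>; by polarization its values there are
  determined by its quadratic form \<open>\<langle>f, T f\<rangle> = \<integral> \<phi>(t) d\<langle>f, E(t) f\<rangle>\<close>.\<close>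

definition is_spectral_integral ::
  "(real set \<Rightarrow> 'a::complex_inner \<Rightarrow> 'a) \<Rightarrow> (real \<Rightarrow> real) \<Rightarrow> 'a set \<Rightarrow> ('a \<Rightarrow> 'a) \<Rightarrow> bool" where
  "is_spectral_integral E \<phi> D T \<longleftrightarrow> D = fcalc_dom E \<phi> \<and> linear_operator D T \<and>
     (\<forall>f\<in>D. cinner f (T f) = complex_of_real (\<integral>t. \<phi> t \<partial>scalar_measure E f))"

definition fcalc :: "(real set \<Rightarrow> 'a::complex_inner \<Rightarrow> 'a) \<Rightarrow> (real \<Rightarrow> real) \<Rightarrow> 'a \<Rightarrow> 'a" where
  "fcalc E \<phi> = (SOME T. is_spectral_integral E \<phi> (fcalc_dom E \<phi>) T)"

text \<open>\<open>E\<close> is the spectral measure of \<open>A\<close>, that is \<open>A = \<integral> t dE(t)\<close> and \<open>E B = \<chi>\<^sub>A(B)\<close>. By the spectral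
  theorem every self-adjoint operator has exactly one (up to its values on non-Borel sets).\<close>

definition spectral_measure_of ::
  "'a::complex_inner set \<Rightarrow> ('a \<Rightarrow> 'a) \<Rightarrow> (real set \<Rightarrow> 'a \<Rightarrow> 'a) \<Rightarrow> bool" where
  "spectral_measure_of D A E \<longleftrightarrow>
     projection_valued_measure E \<and> is_spectral_integral E (\<lambda>t. t) D A"

section \<open>Energy, local trace and density\<close>

text \<open>Below, \<open>E\<close> is the spectral measure of \<open>A\<close>, so that \<open>fcalc E sqrt\<close> is \<open>A\<^sup>1\<^sup>/\<^sup>2\<close>; the values of
  \<open>sqrt\<close> at negative numbers play no role since \<open>A\<close> is positive.\<close>

text \<open>\<open>\<parallel>A\<^sup>1\<^sup>/\<^sup>2 \<rho>\<^sup>1\<^sup>/\<^sup>2\<parallel>\<^sub>H\<^sub>S\<^sup>2\<close>, infinite if the range of \<open>\<rho>\<^sup>1\<^sup>/\<^sup>2\<close> is not contained in the domain of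
  \<open>A\<^sup>1\<^sup>/\<^sup>2\<close>.\<close>

definition energy ::
  "(real set \<Rightarrow> 'a::complex_inner \<Rightarrow> 'a) \<Rightarrow> ('a \<Rightarrow> 'a) \<Rightarrow> ennreal" where
  "energy E \<rho> =
     (if range (sqrt_op \<rho>) \<subseteq> fcalc_dom E sqrt
      then \<Sum>\<^sub>\<infinity>e\<in>some_basis. ennreal ((norm (fcalc E sqrt (sqrt_op \<rho> e)))\<^sup>2)
      else \<infinity>)"

definition expectation_value ::
  "(real set \<Rightarrow> 'a::complex_inner \<Rightarrow> 'a) \<Rightarrow> ('a \<Rightarrow> 'a) \<Rightarrow> real" where
  "expectation_value E \<rho> = enn2real (energy E \<rho> / op_trace \<rho>)"

definition nu ::
  "(('x::sigma_finite_space, 'h::separable_hilbert) L2 \<Rightarrow> ('x, 'h) L2) \<Rightarrow> 'x set \<Rightarrow> ennreal" where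
  "nu P \<Omega> = op_trace (chi \<Omega> \<circ> P \<circ> chi \<Omega>)"

definition nu_measure ::
  "(('x::sigma_finite_space, 'h::separable_hilbert) L2 \<Rightarrow> ('x, 'h) L2) \<Rightarrow> 'x measure" where
  "nu_measure P = measure_of (space \<mu>) (sets \<mu>) (nu P)"

definition op_density ::
  "(('x::sigma_finite_space, 'h::separable_hilbert) L2 \<Rightarrow> ('x, 'h) L2) \<Rightarrow> ennreal" where
  "op_density P = esssup \<mu> (RN_deriv \<mu> (nu_measure P))"

text \<open>The spectral projections \<open>\<Pi>\<^sub>\<lambda>\<close> are \<open>\<chi>\<^sub>A(]0,\<lambda>])\<close> if \<open>excl_zero\<close> holds and \<open>\<chi>\<^sub>A([0,\<lambda>])\<close> otherwise.\<close>

definition spec_proj :: "bool \<Rightarrow> (real set \<Rightarrow> 'a \<Rightarrow> 'a) \<Rightarrow> real \<Rightarrow> 'a \<Rightarrow> 'a" where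
  "spec_proj excl_zero E l = (if excl_zero then E {0<..l} else E {0..l})"

definition F_density :: "bool \<Rightarrow>
    (real set \<Rightarrow> ('x::sigma_finite_space, 'h::separable_hilbert) L2 \<Rightarrow> ('x, 'h) L2) \<Rightarrow>
    real \<Rightarrow> ennreal" where
  "F_density excl_zero E l = op_density (spec_proj excl_zero E l)"

definition F_local :: "bool \<Rightarrow>
    (real set \<Rightarrow> ('x::sigma_finite_space, 'h::separable_hilbert) L2 \<Rightarrow> ('x, 'h) L2) \<Rightarrow>
    'x set \<Rightarrow> real \<Rightarrow> ennreal" where
  "F_local excl_zero E \<Omega> l = nu (spec_proj excl_zero E l) \<Omega>"

text \<open>\<open>F\<^sub>\<Omega>\<^sup>d\<^sup>i\<^sup>m\<close>; the inequality \<open>\<E> \<le> \<lambda>\<close> on \<open>V\<close> includes that \<open>V\<close> lies in the domain of \<open>A\<^sup>1\<^sup>/\<^sup>2\<close>.\<close>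

definition F_dim :: "bool \<Rightarrow> ('x::sigma_finite_space, 'h::separable_hilbert) L2 set \<Rightarrow>
    (('x, 'h) L2 \<Rightarrow> ('x, 'h) L2) \<Rightarrow> (real set \<Rightarrow> ('x, 'h) L2 \<Rightarrow> ('x, 'h) L2) \<Rightarrow>
    'x set \<Rightarrow> real \<Rightarrow> ennreal" where
  "F_dim excl_zero D A E \<Omega> l =
     (SUP V \<in> {V. (\<exists>B. finite B \<and> V = complex_vector.span B) \<and>
                  (\<forall>f\<in>V. vanishes_outside \<Omega> f) \<and>
                  (\<forall>f\<in>V. f \<in> fcalc_dom E sqrt \<and>
                          (norm (fcalc E sqrt f))\<^sup>2 \<le> l * (norm f)\<^sup>2) \<and>
                  (excl_zero \<longrightarrow> (\<forall>f\<in>V. \<forall>g\<in>null_space D A. cinner g f = 0))}.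
        of_nat (complex_vector.dim V))"

end

theory Submission
  imports Defs
begin

text \<open>Put \<open>S = \<rho>\<^sup>1\<^sup>/\<^sup>2\<close> and split \<open>\<tau>(\<rho>) = \<parallel>S\<parallel>\<^sub>H\<^sub>S\<^sup>2 = \<parallel>\<Pi>\<^sub>\<lambda> S\<parallel>\<^sub>H\<^sub>S\<^sup>2 + \<parallel>(1 - \<Pi>\<^sub>\<lambda>) S\<parallel>\<^sub>H\<^sub>S\<^sup>2\<close>. On
  the range of \<open>1 - \<Pi>\<^sub>\<lambda>\<close> one has \<open>A \<ge> \<lambda>\<close>, so the second term is at most \<open>\<E>(\<rho>) / \<lambda>\<close>, which is
  \<open>\<tau>(\<rho>) / 4\<close> for \<open>\<lambda> = 4\<langle>A\<rangle>\<^sub>\<rho>\<close>. Since \<open>S = S \<chi>\<^sub>\<Omega>\<close>, the first term is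
  \<open>\<parallel>S \<chi>\<^sub>\<Omega> \<Pi>\<^sub>\<lambda>\<parallel>\<^sub>H\<^sub>S\<^sup>2 \<le> \<parallel>\<rho>\<parallel> \<tau>(\<chi>\<^sub>\<Omega> \<Pi>\<^sub>\<lambda> \<chi>\<^sub>\<Omega>)\<close>. With \<open>\<lambda> = 1\<close> the same splitting shows that \<open>\<tau>(\<rho>)\<close> is
  finite, without which the expectation value would be meaningless. For the dimension bound the
  splitting is applied to the vectors of an orthonormal basis of \<open>V\<close>, and Bessel's inequality
  replaces the bound on \<open>\<parallel>\<rho>\<parallel>\<close>.\<close>

section \<open>Inner products and symmetric operators\<close>

text \<open>The constants have room to spare: cutting at four times the expectation keeps three
  quarters of the trace in the range of the projection, and only one quarter is claimed. The bulk of
  the work comes from objects given by description or choice: \<open>sqrt_op\<close> is a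
  \<open>THE\<close>, \<open>fcalc\<close> and \<open>some_basis\<close> are \<open>SOME\<close>,
  \<open>scalar_measure\<close> and \<open>nu_measure\<close> are \<open>measure_of\<close>. Roots,
  spectral integrals, bases and countable additivity must be secured before any estimate has
  content, and the existence proofs rest on completeness. A spectral integral is known only through
  its quadratic form, so norms of its values are reached by Cauchy-Schwarz. Two degenerate cases
  need their own argument: spectral mass at or below 0 when the projection omits it, and zero
  energy, where dividing by the threshold is impossible.\<close>

lemma cinner_zero_right [simp]: "cinner x 0 = 0"
  using cinner_scaleC_right[of x 0 0] by simp

lemma cinner_zero_left [simp]: "cinner 0 x = 0"
  using cinner_scaleC_left[of 0 0 x] by simp

lemma cinner_minus_right: "cinner x (- y) = - cinner x y"
  using cinner_add_right[of x y "- y"] by (simp add: eq_neg_iff_add_eq_0 add.commute)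

lemma cinner_minus_left: "cinner (- x) y = - cinner x y"
  using cinner_add_left[of x "- x" y] by (simp add: eq_neg_iff_add_eq_0 add.commute)

lemma cinner_diff_right: "cinner x (y - z) = cinner x y - cinner x z"
  using cinner_add_right[of x y "- z"] by (simp add: cinner_minus_right)

lemma cinner_diff_left: "cinner (x - y) z = cinner x z - cinner y z"
  using cinner_add_left[of x "- y" z] by (simp add: cinner_minus_left)

lemma cinner_sum_right: "cinner x (\<Sum>i\<in>I. f i) = (\<Sum>i\<in>I. cinner x (f i))"
  by (induction I rule: infinite_finite_induct) (simp_all add: cinner_add_right)

lemma cinner_sum_left: "cinner (\<Sum>i\<in>I. f i) x = (\<Sum>i\<in>I. cinner (f i) x)"
  by (induction I rule: infinite_finite_induct) (simp_all add: cinner_add_left)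

lemma cinner_scaleR_right: "cinner x (r *\<^sub>R y) = of_real r * cinner x y"
  by (simp add: scaleR_scaleC cinner_scaleC_right)

lemma cinner_scaleR_left: "cinner (r *\<^sub>R x) y = of_real r * cinner x y"
  by (simp add: scaleR_scaleC cinner_scaleC_left)

lemma cinner_self: "cinner x x = of_real ((norm x)\<^sup>2)"
proof -
  have "Im (cinner x x) = 0"
    using arg_cong[OF cinner_commute[of x x], of Im] by simp
  then show ?thesis
    by (simp add: complex_eq_iff inner_eq_Re_cinner[symmetric] power2_norm_eq_inner)
qed

lemma cinner_eq_zero_commute: "cinner x y = 0 \<longleftrightarrow> cinner y x = 0"
  by (metis cinner_commute complex_cnj_zero)

lemma cmod_cinner_commute: "cmod (cinner x y) = cmod (cinner y x)"
  by (metis cinner_commute complex_mod_cnj)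

lemma cinner_extensionality:
  assumes "\<And>z. cinner z x = cinner z y"
  shows "x = y"
proof -
  have "cinner (x - y) (x - y) = 0"
    by (simp add: cinner_diff_right assms)
  then show ?thesis by (simp add: cinner_self)
qed

text \<open>Multiplying \<open>x\<close> by the inner product itself turns the real part into the
  squared modulus, so the real inequality for the rotated vector gives the complex one after
  cancelling a factor.\<close>

lemma complex_Cauchy_Schwarz: "cmod (cinner x y) \<le> norm x * norm y"
proof (cases "cinner x y = 0")
  case False
  let ?c = "cinner x y"
  have "inner (?c *\<^sub>C x) y = (cmod ?c)\<^sup>2"
    by (simp add: inner_eq_Re_cinner cinner_scaleC_left mult.commute
        complex_norm_square[symmetric] del: of_real_power)
  moreover have "inner (?c *\<^sub>C x) y \<le> norm (?c *\<^sub>C x) * norm y"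
    by (rule norm_cauchy_schwarz)
  ultimately have "cmod ?c * cmod ?c \<le> cmod ?c * (norm x * norm y)"
    by (simp add: norm_scaleC power2_eq_square mult.assoc)
  then show ?thesis
    using False by simp
qed simp

lemma norm_add_orthogonal:
  assumes "cinner x y = 0"
  shows "(norm (x + y))\<^sup>2 = (norm x)\<^sup>2 + (norm y)\<^sup>2"
  using assms by (simp add: power2_norm_eq_inner inner_add_left inner_add_right
      inner_commute[of y x] inner_eq_Re_cinner[of x y])

lemma tendsto_cinner [tendsto_intros]:
  assumes "(f \<longlongrightarrow> a) F" "(g \<longlongrightarrow> b) F"
  shows "((\<lambda>n. cinner (f n) (g n)) \<longlongrightarrow> cinner a b) F"
  unfolding cinner_eq_Complex
  using assms bounded_linear.tendsto[OF bounded_linear_scaleC assms(1)]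
  by (intro tendsto_Complex tendsto_inner) auto

lemma continuous_on_cinner_right: "continuous_on UNIV (\<lambda>x. cinner z x)"
  unfolding continuous_on_def by (auto intro!: tendsto_intros)

lemma cinner_eq_zero_closure:
  assumes "\<And>x. x \<in> S \<Longrightarrow> cinner z x = 0" and "x \<in> closure S"
  shows "cinner z x = 0"
proof -
  have "closed ((\<lambda>x. cinner z x) -` {0})"
    by (intro closed_vimage continuous_on_cinner_right) simp
  then have "closure S \<subseteq> (\<lambda>x. cinner z x) -` {0}"
    using assms(1) by (intro closure_minimal) auto
  then show ?thesis using assms(2) by auto
qed

section \<open>Everywhere defined symmetric operators\<close>

text \<open>A vector is determined by its inner products, so symmetry alone forces linearity, and it
  reduces the graph condition on the adjoint to \<open>P g = h\<close>.\<close>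

lemma self_adjoint_UNIV_iff:
  "self_adjoint UNIV P \<longleftrightarrow> (\<forall>f g. cinner (P f) g = cinner f (P g))"
proof
  assume "self_adjoint UNIV P"
  then show "\<forall>f g. cinner (P f) g = cinner f (P g)"
    unfolding self_adjoint_def by blast
next
  assume sym: "\<forall>f g. cinner (P f) g = cinner f (P g)"
  then have sym': "cinner f (P g) = cinner (P f) g" for f g by simp
  have "P (f + g) = P f + P g" for f g
    by (rule cinner_extensionality) (simp add: sym' cinner_add_right)
  moreover have "P (c *\<^sub>C f) = c *\<^sub>C P f" for c f
    by (rule cinner_extensionality) (simp add: sym' cinner_scaleC_right)
  ultimately have "linear_operator UNIV P"
    by (simp add: linear_operator_def)
  moreover have "(\<forall>f. cinner (P f) g = cinner f h) \<longleftrightarrow> P g = h" for g h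
    using cinner_extensionality[of "P g" h] sym by auto
  ultimately show "self_adjoint UNIV P"
    by (simp add: self_adjoint_def)
qed

lemma positive_bounded_iff:
  "positive_bounded P \<longleftrightarrow> bounded_linear P \<and> (\<forall>f g. cinner (P f) g = cinner f (P g)) \<and>
     (\<forall>f. 0 \<le> Re (cinner f (P f)))"
  by (auto simp: positive_bounded_def positive_self_adjoint_def self_adjoint_UNIV_iff)

lemma orthogonal_projection_iff:
  "orthogonal_projection P \<longleftrightarrow> bounded_linear P \<and> (\<forall>f g. cinner (P f) g = cinner f (P g)) \<and>
     (\<forall>f. P (P f) = P f)"
  by (auto simp: orthogonal_projection_def self_adjoint_UNIV_iff fun_eq_iff)

lemma symmetric_scaleC:
  assumes "\<And>f g. cinner (P f) g = cinner f (P g)"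
  shows "P (c *\<^sub>C f) = c *\<^sub>C P f"
  by (rule cinner_extensionality) (simp add: assms[symmetric] cinner_scaleC_right)

lemma orthogonal_projection_cinner_self:
  "orthogonal_projection P \<Longrightarrow> cinner f (P f) = of_real ((norm (P f))\<^sup>2)"
  by (metis orthogonal_projection_iff cinner_self)

lemma orthogonal_projection_pythagoras:
  assumes "orthogonal_projection P"
  shows "(norm f)\<^sup>2 = (norm (P f))\<^sup>2 + (norm (f - P f))\<^sup>2"
proof -
  have "cinner (P f) (f - P f) = 0"
    using assms by (simp add: orthogonal_projection_iff cinner_diff_right)
  from norm_add_orthogonal[OF this] show ?thesis by simp
qed

text \<open>The quadratic form is nonnegative at \<open>f - K\<^sup>-\<^sup>1 P f\<close>.\<close>

lemma positive_bounded_norm_power2_le: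
  assumes P: "positive_bounded P"
  shows "(norm (P f))\<^sup>2 \<le> onorm P * Re (cinner f (P f))"
proof -
  have bl: "bounded_linear P" and sym: "\<And>f g. cinner (P f) g = cinner f (P g)"
    and pos: "\<And>f. 0 \<le> Re (cinner f (P f))"
    using P by (auto simp: positive_bounded_iff)
  interpret bounded_linear P by fact
  define K where "K = onorm P"
  define a where "a = Re (cinner f (P f))"
  define b where "b = (norm (P f))\<^sup>2"
  have le: "norm (P g) \<le> K * norm g" for g
    unfolding K_def by (rule onorm[OF bl])
  show ?thesis
  proof (cases "K = 0")
    case True
    then show ?thesis using le[of f] by (simp add: K_def)
  next
    case False
    then have K: "K > 0" using onorm_pos_le[OF bl] by (simp add: K_def)
    define t where "t = inverse K"
    have t: "t > 0" "t * K = 1" using K by (auto simp: t_def)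
    have c: "Re (cinner (P f) (P (P f))) \<le> K * b"
    proof -
      have "Re (cinner (P f) (P (P f))) \<le> norm (P f) * norm (P (P f))"
        using complex_Cauchy_Schwarz complex_Re_le_cmod order_trans by blast
      also have "\<dots> \<le> norm (P f) * (K * norm (P f))"
        by (intro mult_left_mono le) simp
      finally show ?thesis by (simp add: b_def power2_eq_square mult_ac)
    qed
    have "cinner (f - t *\<^sub>R P f) (P (f - t *\<^sub>R P f)) =
       cinner f (P f) - 2 * of_real t * cinner (P f) (P f) + of_real (t^2) * cinner (P f) (P (P f))"
      by (simp add: diff scaleR cinner_diff_left cinner_diff_right cinner_scaleR_left
          cinner_scaleR_right sym[symmetric] power2_eq_square algebra_simps)
    then have "Re (cinner (f - t *\<^sub>R P f) (P (f - t *\<^sub>R P f))) =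
       a - 2 * t * b + t^2 * Re (cinner (P f) (P (P f)))"
      by (simp add: a_def b_def cinner_self del: of_real_power)
    moreover have "t^2 * Re (cinner (P f) (P (P f))) \<le> t^2 * (K * b)"
      using c by (intro mult_left_mono) auto
    moreover have "t^2 * (K * b) = t * b"
      using t(2) by (simp add: power2_eq_square)
    ultimately have "0 \<le> a - t * b"
      using pos[of "f - t *\<^sub>R P f"] by simp
    then have "b \<le> K * a"
      using K by (simp add: t_def field_simps)
    then show ?thesis by (simp add: a_def b_def K_def)
  qed
qed

lemma positive_bounded_form_eq_zero:
  "positive_bounded P \<Longrightarrow> Re (cinner f (P f)) = 0 \<Longrightarrow> P f = 0"
  using positive_bounded_norm_power2_le[of P f] by simp

section \<open>Square roots of positive bounded operators\<close>

text \<open>For \<open>0 \<le> P \<le> 1\<close> the square root is \<open>1 - Y\<close>, where \<open>Y\<close> is the limit of the following iteration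
  with \<open>B = 1 - P\<close>. Its convergence is dominated by that of the scalar iteration with \<open>B = 1\<close>.\<close>

primrec sqrt_iter :: "('a::real_normed_vector \<Rightarrow>\<^sub>L 'a) \<Rightarrow> nat \<Rightarrow> ('a \<Rightarrow>\<^sub>L 'a)" where
  "sqrt_iter B 0 = 0"
| "sqrt_iter B (Suc n) = (1/2) *\<^sub>R (B + (sqrt_iter B n o\<^sub>L sqrt_iter B n))"

primrec sqrt_scalar_iter :: "nat \<Rightarrow> real" where
  "sqrt_scalar_iter 0 = 0"
| "sqrt_scalar_iter (Suc n) = (1 + (sqrt_scalar_iter n)\<^sup>2) / 2"

lemma sqrt_scalar_iter_bounds: "0 \<le> sqrt_scalar_iter n \<and> sqrt_scalar_iter n \<le> 1"
  by (induction n) (auto simp: power_le_one)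

lemma sqrt_scalar_iter_mono: "m \<le> n \<Longrightarrow> sqrt_scalar_iter m \<le> sqrt_scalar_iter n"
proof (rule lift_Suc_mono_le[of sqrt_scalar_iter])
  show "sqrt_scalar_iter n \<le> sqrt_scalar_iter (Suc n)" for n
    using zero_le_power2[of "1 - sqrt_scalar_iter n"] by (simp add: power2_diff)
qed

lemma sqrt_scalar_iter_Cauchy: "Cauchy sqrt_scalar_iter"
proof (rule convergent_Cauchy, rule Bseq_monoseq_convergent)
  show "Bseq sqrt_scalar_iter"
    using sqrt_scalar_iter_bounds by (intro BseqI'[of _ 1]) auto
  show "monoseq sqrt_scalar_iter"
    using sqrt_scalar_iter_mono by (simp add: monoseq_def)
qed

lemma norm_sqrt_iter_le:
  assumes "norm B \<le> 1"
  shows "norm (sqrt_iter B n) \<le> sqrt_scalar_iter n"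
proof (induction n)
  case (Suc n)
  have "norm (sqrt_iter B n o\<^sub>L sqrt_iter B n) \<le> (sqrt_scalar_iter n)\<^sup>2"
    unfolding power2_eq_square
    by (rule order_trans[OF norm_blinfun_compose]) (intro mult_mono Suc, auto simp: sqrt_scalar_iter_bounds)
  then show ?case
    using assms norm_triangle_ineq[of B "sqrt_iter B n o\<^sub>L sqrt_iter B n"] by simp
qed simp

text \<open>The factorization \<open>X^2 - Y^2 = X (X - Y) + (X - Y) Y\<close> holds without
  commutativity and matches that of \<open>x^2 - y^2\<close> term by term, so the scalar bound is
  inherited. With the gap \<open>k\<close> fixed, the induction on \<open>n\<close> starts from the
  norm bound on the iterates.\<close>

lemma norm_sqrt_iter_diff_le:
  assumes B: "norm B \<le> 1"
  shows "norm (sqrt_iter B (n + k) - sqrt_iter B n) \<le> sqrt_scalar_iter (n + k) - sqrt_scalar_iter n"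
proof (induction n)
  case 0
  show ?case using norm_sqrt_iter_le[OF B] by simp
next
  case (Suc n)
  define X Y x y where "X = sqrt_iter B (n + k)" "Y = sqrt_iter B n"
    "x = sqrt_scalar_iter (n + k)" "y = sqrt_scalar_iter n"
  note D = this
  have IH: "norm (X - Y) \<le> x - y" using Suc by (simp add: D)
  have X: "norm X \<le> x" and Y: "norm Y \<le> y"
    using norm_sqrt_iter_le[OF B] by (auto simp: D)
  have xy: "0 \<le> x" "0 \<le> y" using sqrt_scalar_iter_bounds by (auto simp: D)
  have "(X o\<^sub>L X) - (Y o\<^sub>L Y) = (X o\<^sub>L (X - Y)) + ((X - Y) o\<^sub>L Y)"
    by (simp add: bounded_bilinear.diff_left[OF bounded_bilinear_blinfun_compose]
        bounded_bilinear.diff_right[OF bounded_bilinear_blinfun_compose])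
  also have "norm \<dots> \<le> x * (x - y) + (x - y) * y"
    by (rule order_trans[OF norm_triangle_ineq]; rule add_mono; rule order_trans[OF norm_blinfun_compose])
       (use IH X Y xy order_trans[OF norm_ge_zero IH] in \<open>auto intro!: mult_mono\<close>)
  also have "\<dots> = x\<^sup>2 - y\<^sup>2" by (simp add: power2_eq_square algebra_simps)
  finally have *: "norm ((X o\<^sub>L X) - (Y o\<^sub>L Y)) \<le> x\<^sup>2 - y\<^sup>2" .
  have "sqrt_iter B (Suc n + k) - sqrt_iter B (Suc n) = (1/2) *\<^sub>R ((X o\<^sub>L X) - (Y o\<^sub>L Y))"
    by (simp add: D scaleR_right_diff_distrib[symmetric])
  then have "norm (sqrt_iter B (Suc n + k) - sqrt_iter B (Suc n)) \<le> (x\<^sup>2 - y\<^sup>2) / 2"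
    using * by simp
  also have "\<dots> = sqrt_scalar_iter (Suc n + k) - sqrt_scalar_iter (Suc n)"
    by (simp add: D diff_divide_distrib[symmetric])
  finally show ?case .
qed

lemma sqrt_iter_convergent:
  fixes B :: "'a::banach \<Rightarrow>\<^sub>L 'a"
  assumes B: "norm B \<le> 1"
  shows "convergent (sqrt_iter B)"
proof (rule Cauchy_convergent, rule CauchyI)
  fix e :: real assume e: "0 < e"
  from CauchyD[OF sqrt_scalar_iter_Cauchy e] obtain M where M: "\<And>m n. m \<ge> M \<Longrightarrow> n \<ge> M \<Longrightarrow> norm (sqrt_scalar_iter m - sqrt_scalar_iter n) < e"
    by blast
  have *: "norm (sqrt_iter B m - sqrt_iter B n) < e" if "M \<le> n" "n \<le> m" for m n
    using norm_sqrt_iter_diff_le[OF B, of n "m - n"] M[of m n] that by auto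
  show "\<exists>M. \<forall>m\<ge>M. \<forall>n\<ge>M. norm (sqrt_iter B m - sqrt_iter B n) < e"
  proof (intro exI[of _ M] allI impI)
    fix m n assume "M \<le> m" "M \<le> n"
    then show "norm (sqrt_iter B m - sqrt_iter B n) < e"
      using *[of n m] *[of m n] by (cases "n \<le> m") (auto simp: norm_minus_commute)
  qed
qed

lemma blinfun_apply_tendsto: "X \<longlonglongrightarrow> Y \<Longrightarrow> (\<lambda>n. blinfun_apply (X n) x) \<longlonglongrightarrow> blinfun_apply Y x"
  by (intro tendsto_intros)

text \<open>The commutation clause is kept for the uniqueness proof. The iterates are polynomials in
  \<open>P\<close>, so a bounded operator commuting with \<open>P\<close> commutes with them and, by
  continuity, with their limit.\<close>

lemma sqrt_exists_contraction:
  fixes P :: "'a::{complex_inner,banach} \<Rightarrow> 'a"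
  assumes P: "positive_bounded P" and K: "onorm P \<le> 1"
  shows "\<exists>S. positive_bounded S \<and> S \<circ> S = P \<and>
    (\<forall>C. bounded_linear C \<longrightarrow> C \<circ> P = P \<circ> C \<longrightarrow> C \<circ> S = S \<circ> C)"
proof -
  have bl: "bounded_linear P" and sym: "\<And>f g. cinner (P f) g = cinner f (P g)"
    and pos: "\<And>f. 0 \<le> Re (cinner f (P f))"
    using P by (auto simp: positive_bounded_iff)
  interpret P: bounded_linear P by fact
  define B where "B = Blinfun (\<lambda>x. x - P x)"
  have B: "blinfun_apply B x = x - P x" for x
    unfolding B_def using bl by (subst bounded_linear_Blinfun_apply) (auto intro: bounded_linear_sub bounded_linear_ident)
  \<comment> \<open>In \<open>|x|^2 - 2 <x, P x> + |P x|^2\<close> the last term is at most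
    \<open><x, P x>\<close>, because \<open>onorm P \<le> 1\<close>.\<close>
  have nB: "norm B \<le> 1"
  proof (rule norm_blinfun_bound)
    fix x
    have "(norm (P x))\<^sup>2 \<le> 1 * Re (cinner x (P x))"
      using positive_bounded_norm_power2_le[OF P, of x] mult_right_mono[OF K pos[of x]] by simp
    then have "(norm (x - P x))\<^sup>2 \<le> (norm x)\<^sup>2"
      using pos[of x] by (simp add: power2_norm_eq_inner inner_diff_left inner_diff_right
          inner_commute[of "P x" x] inner_eq_Re_cinner[of x "P x"])
    then show "norm (blinfun_apply B x) \<le> 1 * norm x"
      by (simp add: B power2_le_iff_abs_le)
  qed simp
  obtain Y where Y: "sqrt_iter B \<longlonglongrightarrow> Y"
    using sqrt_iter_convergent[OF nB] by (auto simp: convergent_def)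
  have "(\<lambda>n. sqrt_iter B (Suc n)) \<longlonglongrightarrow> (1/2) *\<^sub>R (B + (Y o\<^sub>L Y))"
    unfolding sqrt_iter.simps
    by (intro tendsto_intros bounded_bilinear.tendsto[OF bounded_bilinear_blinfun_compose] Y)
  then have "Y = (1/2) *\<^sub>R (B + (Y o\<^sub>L Y))"
    using LIMSEQ_unique LIMSEQ_Suc[OF Y] by blast
  then have "2 *\<^sub>R Y = 2 *\<^sub>R ((1/2) *\<^sub>R (B + (Y o\<^sub>L Y)))" by (rule arg_cong)
  \<comment> \<open>The fixed point equation says \<open>(1 - Y)^2 = 1 - B = P\<close>.\<close>
  then have YB: "2 *\<^sub>R Y = B + (Y o\<^sub>L Y)" by (simp del: scaleR_add_right)
  have nY: "norm Y \<le> 1"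
    using norm_sqrt_iter_le[OF nB] sqrt_scalar_iter_bounds
    by (intro Lim_bounded[OF tendsto_norm[OF Y]]) (meson order_trans)
  have symB: "cinner (blinfun_apply B f) g = cinner f (blinfun_apply B g)" for f g
    by (simp add: B cinner_diff_left cinner_diff_right sym)
  have "cinner (blinfun_apply (sqrt_iter B n) f) g = cinner f (blinfun_apply (sqrt_iter B n) g)" for n f g
    by (induction n arbitrary: f g)
       (simp_all add: cinner_scaleR_left cinner_scaleR_right cinner_add_left cinner_add_right
         plus_blinfun.rep_eq scaleR_blinfun.rep_eq symB)
  then have symY: "cinner (blinfun_apply Y f) g = cinner f (blinfun_apply Y g)" for f g
    using LIMSEQ_unique[OF tendsto_cinner[OF blinfun_apply_tendsto[OF Y, of f] tendsto_const[of g]]]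
       tendsto_cinner[OF tendsto_const[of f] blinfun_apply_tendsto[OF Y, of g]] by simp
  define S where "S x = x - blinfun_apply Y x" for x
  have "bounded_linear S"
    unfolding S_def by (intro bounded_linear_sub bounded_linear_ident blinfun.bounded_linear_right)
  moreover have "cinner (S f) g = cinner f (S g)" for f g
    by (simp add: S_def cinner_diff_left cinner_diff_right symY)
  moreover have "0 \<le> Re (cinner f (S f))" for f
  proof -
    have "Re (cinner f (blinfun_apply Y f)) \<le> norm f * norm (blinfun_apply Y f)"
      using complex_Cauchy_Schwarz complex_Re_le_cmod order_trans by blast
    also have "\<dots> \<le> norm f * (1 * norm f)"
      using norm_blinfun[of Y f] nY
      by (intro mult_left_mono order_trans[OF norm_blinfun] mult_right_mono) auto
    finally show ?thesis
      by (simp add: S_def cinner_diff_right cinner_self power2_eq_square)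
  qed
  moreover have "S (S x) = P x" for x
  proof -
    have "2 *\<^sub>R blinfun_apply Y x = x - P x + blinfun_apply Y (blinfun_apply Y x)"
      using arg_cong[OF YB, of "\<lambda>T. blinfun_apply T x"]
      by (simp add: scaleR_blinfun.rep_eq plus_blinfun.rep_eq B)
    then show ?thesis
      by (simp add: S_def blinfun.diff_right scaleR_2 algebra_simps)
  qed
  moreover have "C (S x) = S (C x)" if "bounded_linear C" and CP: "C \<circ> P = P \<circ> C" for C x
  proof -
    interpret C: bounded_linear C by fact
    have "C (P x) = P (C x)" for x
      using CP by (simp add: fun_eq_iff)
    then have "C (blinfun_apply (sqrt_iter B n) x) = blinfun_apply (sqrt_iter B n) (C x)" for n x
      by (induction n arbitrary: x)
         (simp_all add: C.zero C.scaleR C.add C.diff plus_blinfun.rep_eq scaleR_blinfun.rep_eq B)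
    then have "C (blinfun_apply Y x) = blinfun_apply Y (C x)"
      using LIMSEQ_unique[OF C.tendsto[OF blinfun_apply_tendsto[OF Y, of x]]]
        blinfun_apply_tendsto[OF Y, of "C x"] by simp
    then show ?thesis by (simp add: S_def C.diff)
  qed
  ultimately show ?thesis
    by (intro exI[of _ S]) (simp add: positive_bounded_iff fun_eq_iff)
qed

lemma sqrt_exists:
  fixes P :: "'a::{complex_inner,banach} \<Rightarrow> 'a"
  assumes P: "positive_bounded P"
  shows "\<exists>S. positive_bounded S \<and> S \<circ> S = P \<and>
    (\<forall>C. bounded_linear C \<longrightarrow> C \<circ> P = P \<circ> C \<longrightarrow> C \<circ> S = S \<circ> C)"
proof -
  have bl: "bounded_linear P" and sym: "\<And>f g. cinner (P f) g = cinner f (P g)"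
    and pos: "\<And>f. 0 \<le> Re (cinner f (P f))"
    using P by (auto simp: positive_bounded_iff)
  \<comment> \<open>The added 1 keeps the scaling factor positive even for
    \<open>P = 0\<close>.\<close>
  define K where "K = onorm P + 1"
  have K: "K > 0" "onorm P \<le> K" using onorm_pos_le[OF bl] by (auto simp: K_def)
  define Q where "Q x = inverse K *\<^sub>R P x" for x
  have "onorm Q = inverse K * onorm P"
    unfolding Q_def using K by (subst onorm_scaleR[OF bl]) auto
  then have "onorm Q \<le> 1"
    using K mult_left_mono[of "onorm P" K "inverse K"] by simp
  moreover have "positive_bounded Q"
    using sym pos K unfolding Q_def positive_bounded_iff
    by (auto simp: cinner_scaleR_left cinner_scaleR_right intro: bounded_linear_const_scaleR bl)
  ultimately obtain R where R: "positive_bounded R" "R \<circ> R = Q"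
    "\<And>C. bounded_linear C \<Longrightarrow> C \<circ> Q = Q \<circ> C \<Longrightarrow> C \<circ> R = R \<circ> C"
    using sqrt_exists_contraction by blast
  interpret R: bounded_linear R using R(1) by (simp add: positive_bounded_iff)
  define S where "S x = sqrt K *\<^sub>R R x" for x
  have "positive_bounded S"
    using R(1) K unfolding S_def positive_bounded_iff
    by (auto simp: cinner_scaleR_left cinner_scaleR_right intro: bounded_linear_const_scaleR)
  moreover have "S \<circ> S = P"
  proof
    fix x
    have "R (R x) = inverse K *\<^sub>R P x"
      using R(2) by (simp add: fun_eq_iff Q_def)
    then show "(S \<circ> S) x = P x"
      using K by (simp add: S_def R.scaleR mult.assoc[symmetric])
  qed
  moreover have "C \<circ> S = S \<circ> C" if C: "bounded_linear C" "C \<circ> P = P \<circ> C" for C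
  proof -
    interpret C: bounded_linear C by fact
    have "C \<circ> Q = Q \<circ> C" using C(2) by (auto simp: Q_def fun_eq_iff C.scaleR)
    then show ?thesis using R(3)[OF C(1)] by (auto simp: S_def fun_eq_iff C.scaleR)
  qed
  ultimately show ?thesis by blast
qed

text \<open>\<open>R\<close> commutes with \<open>R \<circ> R = P\<close>, hence with
  \<open>S\<close>, so \<open>S + R\<close> kills \<open>y = S x - R x\<close>. Two nonnegative
  forms sum to zero at \<open>y\<close>, hence \<open>S y = R y = 0\<close>, and by symmetry the
  squared norm of \<open>y\<close> is \<open><x, (S - R) y> = 0\<close>.\<close>

lemma sqrt_unique:
  assumes S: "positive_bounded S" "S \<circ> S = P"
    and comm: "\<And>C. bounded_linear C \<Longrightarrow> C \<circ> P = P \<circ> C \<Longrightarrow> C \<circ> S = S \<circ> C"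
    and R: "positive_bounded R" "R \<circ> R = P"
  shows "R = S"
proof
  fix x
  interpret S: bounded_linear S using S(1) by (simp add: positive_bounded_iff)
  interpret R: bounded_linear R using R(1) by (simp add: positive_bounded_iff)
  have "R \<circ> S = S \<circ> R"
    by (rule comm) (use R.bounded_linear_axioms R(2) in auto)
  then have RS: "R (S x) = S (R x)" for x by (simp add: fun_eq_iff)
  have SS: "S (S x) = R (R x)" for x using S(2) R(2) by (metis comp_apply)
  define y where "y = S x - R x"
  have "S y + R y = 0"
    by (simp add: y_def S.diff R.diff RS SS)
  then have "Re (cinner y (S y)) + Re (cinner y (R y)) = 0"
    by (metis cinner_add_right cinner_zero_right plus_complex.sel(1) zero_complex.sel(1))
  moreover have "0 \<le> Re (cinner y (S y))" "0 \<le> Re (cinner y (R y))"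
    using S(1) R(1) by (auto simp: positive_bounded_iff)
  ultimately have "Re (cinner y (S y)) = 0" "Re (cinner y (R y)) = 0" by linarith+
  then have "S y = 0" "R y = 0"
    using positive_bounded_form_eq_zero[OF S(1)] positive_bounded_form_eq_zero[OF R(1)] by auto
  moreover have "cinner (S x) y = cinner x (S y)" "cinner (R x) y = cinner x (R y)"
    using S(1) R(1) unfolding positive_bounded_iff by blast+
  ultimately have "cinner (S x - R x) y = 0"
    by (simp add: cinner_diff_left)
  then have "cinner y y = 0" by (simp only: y_def)
  then show "R x = S x" by (simp add: cinner_self y_def)
qed

lemma sqrt_op:
  fixes P :: "'a::{complex_inner,banach} \<Rightarrow> 'a"
  assumes "positive_bounded P"
  shows "positive_bounded (sqrt_op P)" and "sqrt_op P (sqrt_op P x) = P x"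
proof -
  from sqrt_exists[OF assms] obtain S where S: "positive_bounded S" "S \<circ> S = P"
    and comm: "\<forall>C. bounded_linear C \<longrightarrow> C \<circ> P = P \<circ> C \<longrightarrow> C \<circ> S = S \<circ> C"
    by (elim exE conjE)
  have uniq: "R = S" if "positive_bounded R \<and> R \<circ> R = P" for R
    using that comm by (intro sqrt_unique[OF S]) auto
  have "sqrt_op P = S"
    unfolding sqrt_op_def by (rule the_equality, rule conjI[OF S], rule uniq)
  then show "positive_bounded (sqrt_op P)" "sqrt_op P (sqrt_op P x) = P x"
    using S(1) fun_cong[OF S(2), of x] by auto
qed

section \<open>Sums of nonnegative extended reals over arbitrary index sets\<close>

lemma ennreal_summable_on: "(f :: 'a \<Rightarrow> ennreal) summable_on A"
  by (rule nonneg_summable_on_complete) simp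

lemma infsum_ennreal_SUP:
  fixes f :: "'a \<Rightarrow> ennreal"
  shows "infsum f A = (SUP F\<in>{F. finite F \<and> F \<subseteq> A}. sum f F)"
  by (rule nonneg_infsum_complete) simp

lemma infsum_ennreal_upper:
  fixes f :: "'a \<Rightarrow> ennreal"
  shows "finite F \<Longrightarrow> F \<subseteq> A \<Longrightarrow> sum f F \<le> infsum f A"
  unfolding infsum_ennreal_SUP by (intro SUP_upper) simp

lemma infsum_ennreal_least:
  fixes f :: "'a \<Rightarrow> ennreal"
  assumes "\<And>F. finite F \<Longrightarrow> F \<subseteq> A \<Longrightarrow> sum f F \<le> b"
  shows "infsum f A \<le> b"
  unfolding infsum_ennreal_SUP using assms by (intro SUP_least) simp

lemma infsum_ennreal_mono:
  fixes f :: "'a \<Rightarrow> ennreal"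
  shows "(\<And>x. x \<in> A \<Longrightarrow> f x \<le> g x) \<Longrightarrow> infsum f A \<le> infsum g A"
  by (intro infsum_mono ennreal_summable_on)

lemma infsum_ennreal_cmult:
  fixes f :: "'a \<Rightarrow> ennreal"
  shows "infsum (\<lambda>x. c * f x) A = c * infsum f A"
  unfolding infsum_ennreal_SUP sum_distrib_left[symmetric]
  by (rule SUP_mult_left_ennreal[symmetric])

lemma infsum_ennreal_add:
  fixes f :: "'a \<Rightarrow> ennreal"
  shows "infsum (\<lambda>x. f x + g x) A = infsum f A + infsum g A"
  by (intro infsum_add ennreal_summable_on)

lemma infsum_ennreal_sum:
  fixes f :: "'i \<Rightarrow> 'a \<Rightarrow> ennreal"
  shows "infsum (\<lambda>x. \<Sum>i\<in>I. f i x) A = (\<Sum>i\<in>I. infsum (f i) A)"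
  by (induction I rule: infinite_finite_induct) (simp_all add: infsum_ennreal_add)

text \<open>A finite sum may be pulled through an infinite one, and finite partial sums exhaust the
  outer sum. Tonelli in this form covers uncountable index sets, as orthonormal bases here may
  be.\<close>

lemma infsum_ennreal_swap_le:
  fixes f :: "'a \<Rightarrow> 'b \<Rightarrow> ennreal"
  shows "infsum (\<lambda>x. infsum (f x) B) A \<le> infsum (\<lambda>y. infsum (\<lambda>x. f x y) A) B"
  by (rule infsum_ennreal_least)
     (simp add: infsum_ennreal_sum[symmetric] infsum_ennreal_mono infsum_ennreal_upper)

lemma infsum_ennreal_swap:
  fixes f :: "'a \<Rightarrow> 'b \<Rightarrow> ennreal"
  shows "infsum (\<lambda>x. infsum (f x) B) A = infsum (\<lambda>y. infsum (\<lambda>x. f x y) A) B"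
  by (intro antisym infsum_ennreal_swap_le)

lemma infsum_ennreal_nat:
  fixes f :: "nat \<Rightarrow> ennreal"
  shows "infsum f UNIV = (\<Sum>n. f n)"
  by (intro sums_unique has_sum_imp_sums has_sum_infsum ennreal_summable_on)

section \<open>Orthonormal bases\<close>

definition orthonormal :: "'a::complex_inner set \<Rightarrow> bool" where
  "orthonormal B \<longleftrightarrow> (\<forall>e\<in>B. norm e = 1) \<and> (\<forall>e\<in>B. \<forall>e'\<in>B. e \<noteq> e' \<longrightarrow> cinner e e' = 0)"

definition finite_proj :: "'a::complex_inner set \<Rightarrow> 'a \<Rightarrow> 'a" where
  "finite_proj F x = (\<Sum>e\<in>F. cinner e x *\<^sub>C e)"

lemma orthonormal_subset: "orthonormal B \<Longrightarrow> F \<subseteq> B \<Longrightarrow> orthonormal F"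
  by (auto simp: orthonormal_def)

lemma orthonormal_insert:
  assumes "orthonormal B" "z \<noteq> 0" "\<And>e. e \<in> B \<Longrightarrow> cinner e z = 0"
  shows "orthonormal (insert (z /\<^sub>R norm z) B)"
proof -
  have "cinner z e = 0" if "e \<in> B" for e
    using assms(3)[OF that] cinner_eq_zero_commute by blast
  then show ?thesis
    using assms by (auto simp: orthonormal_def cinner_scaleR_left cinner_scaleR_right)
qed

lemma finite_proj_in_span: "finite_proj F x \<in> complex_vector.span F"
  unfolding finite_proj_def
  by (intro complex_vector.span_sum complex_vector.span_scale complex_vector.span_base)

lemma cinner_finite_proj:
  assumes "orthonormal F" "finite F" "e \<in> F"
  shows "cinner e (finite_proj F x) = cinner e x"
proof -
  have "cinner e (finite_proj F x) = (\<Sum>e'\<in>F. if e' = e then cinner e x else 0)"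
    unfolding finite_proj_def cinner_sum_right cinner_scaleC_right
    using assms by (intro sum.cong) (auto simp: orthonormal_def cinner_self)
  then show ?thesis using assms by simp
qed

lemma orthogonal_span:
  assumes "\<And>e. e \<in> F \<Longrightarrow> cinner e z = 0" and "y \<in> complex_vector.span F"
  shows "cinner y z = 0"
  using assms(2)
  by (induction rule: complex_vector.span_induct_alt)
     (simp_all add: cinner_add_left cinner_scaleC_left assms(1))

lemma finite_proj_pythagoras:
  assumes "orthonormal F" "finite F"
  shows "(norm x)\<^sup>2 = (\<Sum>e\<in>F. (cmod (cinner e x))\<^sup>2) + (norm (x - finite_proj F x))\<^sup>2"
proof -
  have perp: "cinner (finite_proj F x) (x - finite_proj F x) = 0"
    by (rule orthogonal_span[OF _ finite_proj_in_span])
       (simp add: cinner_diff_right cinner_finite_proj[OF assms])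
  have "cinner (finite_proj F x) (finite_proj F x) = (\<Sum>e\<in>F. of_real ((cmod (cinner e x))\<^sup>2))"
    by (subst finite_proj_def)
       (simp add: cinner_sum_left cinner_scaleC_left cinner_finite_proj[OF assms]
         complex_norm_square[symmetric] mult.commute del: of_real_power)
  then have "complex_of_real ((norm (finite_proj F x))\<^sup>2) = of_real (\<Sum>e\<in>F. (cmod (cinner e x))\<^sup>2)"
    by (simp add: cinner_self)
  then have "(norm (finite_proj F x))\<^sup>2 = (\<Sum>e\<in>F. (cmod (cinner e x))\<^sup>2)"
    by (simp only: of_real_eq_iff)
  then show ?thesis using norm_add_orthogonal[OF perp] by simp
qed

lemma finite_proj_best_approximation:
  assumes "orthonormal F" "finite F" "y \<in> complex_vector.span F"
  shows "norm (x - finite_proj F x) \<le> norm (x - y)"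
proof -
  have "finite_proj F x - y \<in> complex_vector.span F"
    by (intro complex_vector.span_diff finite_proj_in_span assms)
  then have "cinner (finite_proj F x - y) (x - finite_proj F x) = 0"
    by (rule orthogonal_span[rotated]) (simp add: cinner_diff_right cinner_finite_proj[OF assms(1,2)])
  moreover have "x - y = (finite_proj F x - y) + (x - finite_proj F x)" by simp
  ultimately have "(norm (x - y))\<^sup>2 = (norm (finite_proj F x - y))\<^sup>2 + (norm (x - finite_proj F x))\<^sup>2"
    using norm_add_orthogonal by metis
  then show ?thesis by (auto intro: power2_le_imp_le)
qed

section \<open>Existence of orthonormal bases\<close>

text \<open>Midpoints stay in \<open>V\<close>, so by the parallelogram law a minimizing sequence is
  Cauchy; its limit lies in the closure of \<open>V\<close>. If the remainder had a component
  \<open>c\<close> along a unit vector of \<open>V\<close>, removing it would lower the squared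
  distance by \<open>|c|^2\<close> below the infimum.\<close>

lemma closest_point_subspace:
  fixes V :: "'a::{complex_inner,banach} set"
  assumes V: "complex_vector.subspace V"
  shows "\<exists>y\<in>closure V. \<forall>e\<in>V. norm e = 1 \<longrightarrow> cinner e (x - y) = 0"
proof -
  define d where "d = infdist x V"
  have V0: "V \<noteq> {}" using complex_vector.subspace_0[OF V] by auto
  have dle: "d \<le> norm (x - y)" if "y \<in> V" for y
    using infdist_le[OF that, of x] by (simp add: d_def dist_norm)
  have d0: "0 \<le> d" by (simp add: d_def infdist_nonneg)
  have "\<exists>y\<in>V. (norm (x - y))\<^sup>2 < d\<^sup>2 + inverse (real (Suc n))" for n
  proof -
    have "d < sqrt (d\<^sup>2 + inverse (real (Suc n)))"
      by (rule real_less_rsqrt) simp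
    then obtain y where y: "y \<in> V" "dist x y < sqrt (d\<^sup>2 + inverse (real (Suc n)))"
      using V0 unfolding d_def infdist_notempty[OF V0] by (subst (asm) cINF_less_iff) auto
    have "(norm (x - y))\<^sup>2 < (sqrt (d\<^sup>2 + inverse (real (Suc n))))\<^sup>2"
      using y(2) by (intro power_strict_mono) (auto simp: dist_norm)
    also have "\<dots> = d\<^sup>2 + inverse (real (Suc n))"
      by (rule real_sqrt_pow2) simp
    finally show ?thesis using y(1) by blast
  qed
  then obtain Y where Y: "\<And>n. Y n \<in> V" "\<And>n. (norm (x - Y n))\<^sup>2 < d\<^sup>2 + inverse (real (Suc n))"
    by metis
  have diff: "(norm (Y n - Y m))\<^sup>2 \<le> 2 * inverse (real (Suc n)) + 2 * inverse (real (Suc m))" for n m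
  proof -
    have "(1/2) *\<^sub>R (Y n + Y m) \<in> V"
      unfolding scaleR_scaleC
      by (intro complex_vector.subspace_scale[OF V] complex_vector.subspace_add[OF V] Y)
    from dle[OF this] have "d\<^sup>2 \<le> (norm (x - (1/2) *\<^sub>R (Y n + Y m)))\<^sup>2"
      using d0 by (intro power_mono)
    moreover have "(norm (Y n - Y m))\<^sup>2 = 2 * (norm (x - Y n))\<^sup>2 + 2 * (norm (x - Y m))\<^sup>2
        - 4 * (norm (x - (1/2) *\<^sub>R (Y n + Y m)))\<^sup>2"
      by (simp add: power2_norm_eq_inner inner_diff_left inner_diff_right inner_add_left
          inner_add_right inner_commute algebra_simps)
    ultimately show ?thesis using Y(2)[of n] Y(2)[of m] by linarith
  qed
  have "Cauchy Y"
  proof (rule metric_CauchyI)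
    fix e :: real assume e: "0 < e"
    then obtain N where N: "inverse (real (Suc N)) < e\<^sup>2 / 4"
      using reals_Archimedean[of "e\<^sup>2 / 4"] by auto
    have "dist (Y m) (Y n) < e" if "m \<ge> N" "n \<ge> N" for m n
    proof -
      have "inverse (real (Suc m)) \<le> inverse (real (Suc N))" "inverse (real (Suc n)) \<le> inverse (real (Suc N))"
        using that by (auto intro!: le_imp_inverse_le)
      then have "(norm (Y m - Y n))\<^sup>2 < e\<^sup>2"
        using diff[of m n] N by linarith
      then show ?thesis using e by (simp add: dist_norm power2_less_imp_less)
    qed
    then show "\<exists>M. \<forall>m\<ge>M. \<forall>n\<ge>M. dist (Y m) (Y n) < e" by blast
  qed
  then obtain y where y: "Y \<longlonglongrightarrow> y"
    using Cauchy_convergent by (auto simp: convergent_def)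
  have le: "(norm (x - y))\<^sup>2 \<le> d\<^sup>2"
  proof (rule LIMSEQ_le)
    show "(\<lambda>n. (norm (x - Y n))\<^sup>2) \<longlonglongrightarrow> (norm (x - y))\<^sup>2"
      by (intro tendsto_intros y)
    show "(\<lambda>n. d\<^sup>2 + inverse (real (Suc n))) \<longlonglongrightarrow> d\<^sup>2"
      using tendsto_add[OF tendsto_const LIMSEQ_inverse_real_of_nat, of "d\<^sup>2"] by simp
  qed (use Y(2) in \<open>auto intro: less_imp_le\<close>)
  show ?thesis
  proof (intro bexI[of _ y] ballI impI)
    show "y \<in> closure V" using Y(1) y by (auto simp: closure_sequential)
    fix e assume e: "e \<in> V" "norm e = 1"
    define c where "c = cinner e (x - y)"
    \<comment> \<open>The shifted point is a limit of points of \<open>V\<close>, so the infimum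
      bounds its distance from \<open>x\<close> too.\<close>
    have "d \<le> norm (x - (y + c *\<^sub>C e))"
    proof (rule Lim_bounded2)
      show "(\<lambda>n. norm (x - (Y n + c *\<^sub>C e))) \<longlonglongrightarrow> norm (x - (y + c *\<^sub>C e))"
        by (intro tendsto_intros y)
      show "\<forall>n\<ge>0. d \<le> norm (x - (Y n + c *\<^sub>C e))"
        by (intro allI impI dle complex_vector.subspace_add[OF V] complex_vector.subspace_scale[OF V] Y e)
    qed
    then have "d\<^sup>2 \<le> (norm (x - (y + c *\<^sub>C e)))\<^sup>2"
      using d0 by (intro power_mono)
    also have "x - (y + c *\<^sub>C e) = (x - y) - finite_proj {e} (x - y)"
      by (simp add: finite_proj_def c_def)
    also have "(norm \<dots>)\<^sup>2 = (norm (x - y))\<^sup>2 - (cmod c)\<^sup>2"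
      using finite_proj_pythagoras[of "{e}" "x - y"] e by (simp add: orthonormal_def c_def)
    finally have "(cmod c)\<^sup>2 \<le> 0" using le by linarith
    then show "cinner e (x - y) = 0" by (simp add: c_def)
  qed
qed

text \<open>Zorn's lemma gives a maximal orthonormal set without any separability. If its span were
  not dense, the normalized perpendicular from a missed point could be adjoined.\<close>

lemma orthonormal_basis_exists: "\<exists>B::'a::{complex_inner,banach} set. orthonormal_basis B"
proof -
  have "\<exists>M\<in>{B::'a set. orthonormal B}. \<forall>X\<in>{B. orthonormal B}. M \<subseteq> X \<longrightarrow> X = M"
  proof (rule subset_Zorn_nonempty)
    show "{B::'a set. orthonormal B} \<noteq> {}"
      by (auto intro!: exI[of _ "{}"] simp: orthonormal_def)
    fix C :: "'a set set" assume C: "C \<noteq> {}" "subset.chain {B. orthonormal B} C"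
    have "cinner e e' = 0" if "X \<in> C" "Y \<in> C" "e \<in> X" "e' \<in> Y" "e \<noteq> e'" for X Y e e'
    proof -
      have "X \<subseteq> Y \<or> Y \<subseteq> X" "orthonormal X" "orthonormal Y"
        using C(2) that by (auto simp: subset_chain_def)
      then show ?thesis using that by (auto simp: orthonormal_def)
    qed
    moreover have "norm e = 1" if "X \<in> C" "e \<in> X" for X e
      using C(2) that by (auto simp: subset_chain_def orthonormal_def)
    ultimately show "\<Union> C \<in> {B. orthonormal B}"
      unfolding orthonormal_def by blast
  qed
  then obtain B :: "'a set" where B: "orthonormal B"
    and max: "\<And>X. orthonormal X \<Longrightarrow> B \<subseteq> X \<Longrightarrow> X = B" by auto
  have "x \<in> closure (complex_vector.span B)" for x
  proof (rule ccontr)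
    assume x: "x \<notin> closure (complex_vector.span B)"
    obtain y where y: "y \<in> closure (complex_vector.span B)"
      "\<And>e. e \<in> complex_vector.span B \<Longrightarrow> norm e = 1 \<Longrightarrow> cinner e (x - y) = 0"
      using closest_point_subspace[OF complex_vector.subspace_span] by blast
    define z where "z = x - y"
    have z: "z \<noteq> 0" using x y(1) by (auto simp: z_def)
    have perp: "cinner e z = 0" if "e \<in> B" for e
      using y(2)[of e] B that by (auto simp: z_def orthonormal_def intro: complex_vector.span_base)
    have "z /\<^sub>R norm z \<in> B"
      using max[OF orthonormal_insert[OF B z perp]] by auto
    from perp[OF this] have "cinner z z = 0"
      using z by (simp add: cinner_scaleR_left)
    then show False using z by (simp add: cinner_self)
  qed
  then have "orthonormal_basis B"
    using B by (auto simp: orthonormal_basis_def orthonormal_def)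
  then show ?thesis by blast
qed

lemma orthonormal_basis_some_basis: "orthonormal_basis (some_basis :: 'a::{complex_inner,banach} set)"
  unfolding some_basis_def by (rule someI_ex[OF orthonormal_basis_exists])

section \<open>Bessel, Parseval and Hilbert-Schmidt sums\<close>

lemma bessel_infsum:
  assumes "orthonormal B"
  shows "(\<Sum>\<^sub>\<infinity>e\<in>B. ennreal ((cmod (cinner e x))\<^sup>2)) \<le> ennreal ((norm x)\<^sup>2)"
proof (rule infsum_ennreal_least)
  fix F assume F: "finite F" "F \<subseteq> B"
  have "(\<Sum>e\<in>F. (cmod (cinner e x))\<^sup>2) \<le> (norm x)\<^sup>2"
    using finite_proj_pythagoras[OF orthonormal_subset[OF assms F(2)] F(1), of x] by simp
  then show "(\<Sum>e\<in>F. ennreal ((cmod (cinner e x))\<^sup>2)) \<le> ennreal ((norm x)\<^sup>2)"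
    by (simp add: sum_ennreal ennreal_leI)
qed

text \<open>Density supplies a finite combination close to \<open>x\<close>. Projecting onto the
  span of the basis vectors it involves does at least as well, so a finite partial sum already comes
  within \<open>d\<close> of the squared norm.\<close>

lemma parseval:
  assumes B: "orthonormal_basis B"
  shows "(\<Sum>\<^sub>\<infinity>e\<in>B. ennreal ((cmod (cinner e x))\<^sup>2)) = ennreal ((norm x)\<^sup>2)"
proof (rule antisym)
  have on: "orthonormal B" and dense: "closure (complex_vector.span B) = UNIV"
    using B by (auto simp: orthonormal_basis_def orthonormal_def)
  show "(\<Sum>\<^sub>\<infinity>e\<in>B. ennreal ((cmod (cinner e x))\<^sup>2)) \<le> ennreal ((norm x)\<^sup>2)"
    by (rule bessel_infsum[OF on])
  show "ennreal ((norm x)\<^sup>2) \<le> (\<Sum>\<^sub>\<infinity>e\<in>B. ennreal ((cmod (cinner e x))\<^sup>2))"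
  proof (rule ennreal_le_epsilon)
    fix d :: real assume d: "0 < d"
    have "x \<in> closure (complex_vector.span B)" "0 < sqrt d" using dense d by auto
    then have "\<exists>y\<in>complex_vector.span B. dist y x < sqrt d"
      unfolding closure_approachable by simp
    then obtain y where y: "y \<in> complex_vector.span B" "dist y x < sqrt d" by blast
    obtain F where F: "finite F" "F \<subseteq> B" "y \<in> complex_vector.span F"
    proof -
      obtain t r where t: "finite t" "t \<subseteq> B" "y = (\<Sum>a\<in>t. r a *\<^sub>C a)"
        using y(1) by (auto simp: complex_vector.span_explicit)
      have "y \<in> complex_vector.span t"
        unfolding t(3) by (intro complex_vector.span_sum complex_vector.span_scale complex_vector.span_base)
      then show ?thesis by (rule that[OF t(1,2)])
    qed
    have onF: "orthonormal F" by (rule orthonormal_subset[OF on F(2)])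
    have "norm (x - finite_proj F x) \<le> sqrt d"
      using finite_proj_best_approximation[OF onF F(1,3), of x] y(2)
      by (simp add: dist_norm norm_minus_commute)
    then have "(norm (x - finite_proj F x))\<^sup>2 \<le> (sqrt d)\<^sup>2"
      by (intro power_mono) auto
    then have "(norm x)\<^sup>2 \<le> (\<Sum>e\<in>F. (cmod (cinner e x))\<^sup>2) + d"
      using finite_proj_pythagoras[OF onF F(1), of x] d by simp
    then have "ennreal ((norm x)\<^sup>2) \<le> ennreal ((\<Sum>e\<in>F. (cmod (cinner e x))\<^sup>2) + d)"
      by (rule ennreal_leI)
    also have "\<dots> = ennreal (\<Sum>e\<in>F. (cmod (cinner e x))\<^sup>2) + ennreal d"
      using d by (intro ennreal_plus) (auto intro: sum_nonneg)
    also have "\<dots> = (\<Sum>e\<in>F. ennreal ((cmod (cinner e x))\<^sup>2)) + ennreal d"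
      by (simp add: sum_ennreal)
    also have "\<dots> \<le> (\<Sum>\<^sub>\<infinity>e\<in>B. ennreal ((cmod (cinner e x))\<^sup>2)) + ennreal d"
      by (intro add_right_mono infsum_ennreal_upper F)
    finally show "ennreal ((norm x)\<^sup>2) \<le> (\<Sum>\<^sub>\<infinity>e\<in>B. ennreal ((cmod (cinner e x))\<^sup>2)) + ennreal d" .
  qed
qed

text \<open>By Parseval both sides are the sum of \<open>|<e', S e>|^2\<close> over pairs of basis
  vectors, read by rows and by columns. This is the device for reordering factors under a
  Hilbert-Schmidt norm.\<close>

lemma hilbert_schmidt_adjoint:
  assumes B: "orthonormal_basis B" and adj: "\<And>x y. cinner (S x) y = cinner x (T y)"
  shows "(\<Sum>\<^sub>\<infinity>e\<in>B. ennreal ((norm (S e))\<^sup>2)) = (\<Sum>\<^sub>\<infinity>e\<in>B. ennreal ((norm (T e))\<^sup>2))"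
proof -
  have "cmod (cinner e' (S e)) = cmod (cinner e (T e'))" for e e'
    by (metis adj cmod_cinner_commute)
  then have "(\<Sum>\<^sub>\<infinity>e\<in>B. \<Sum>\<^sub>\<infinity>e'\<in>B. ennreal ((cmod (cinner e' (S e)))\<^sup>2)) =
    (\<Sum>\<^sub>\<infinity>e\<in>B. \<Sum>\<^sub>\<infinity>e'\<in>B. ennreal ((cmod (cinner e (T e')))\<^sup>2))"
    by presburger
  also have "\<dots> = (\<Sum>\<^sub>\<infinity>e'\<in>B. \<Sum>\<^sub>\<infinity>e\<in>B. ennreal ((cmod (cinner e (T e')))\<^sup>2))"
    by (rule infsum_ennreal_swap)
  finally show ?thesis by (simp only: parseval[OF B])
qed

text \<open>Gram-Schmidt, one vector at a time: as long as \<open>W\<close> has fewer elements than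
  the dimension, its span misses a vector of the span of \<open>B\<close>, whose component
  orthogonal to \<open>W\<close> is normalized and adjoined.\<close>

lemma orthonormal_in_span_exists:
  assumes B: "finite (B :: 'a::complex_inner set)" and n: "n \<le> complex_vector.dim (complex_vector.span B)"
  shows "\<exists>W. finite W \<and> W \<subseteq> complex_vector.span B \<and> orthonormal W \<and> card W = n"
  using n
proof (induction n)
  case 0
  show ?case by (intro exI[of _ "{}"]) (simp add: orthonormal_def)
next
  case (Suc n)
  then obtain W where W: "finite W" "W \<subseteq> complex_vector.span B" "orthonormal W" "card W = n"
    by auto
  have "\<not> complex_vector.span B \<subseteq> complex_vector.span W"
    using complex_vector.dim_le_card[of "complex_vector.span B" W] W Suc.prems by auto
  then obtain v where v: "v \<in> complex_vector.span B" "v \<notin> complex_vector.span W" by auto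
  define z where "z = v - finite_proj W v"
  have z: "z \<noteq> 0" using v finite_proj_in_span[of W v] by (auto simp: z_def)
  have perp: "cinner e z = 0" if "e \<in> W" for e
    using cinner_finite_proj[OF W(3,1) that] by (simp add: z_def cinner_diff_right)
  have "finite_proj W v \<in> complex_vector.span B"
    using finite_proj_in_span[of W v] complex_vector.span_mono[OF W(2)]
    by (auto simp: complex_vector.span_span)
  then have "z /\<^sub>R norm z \<in> complex_vector.span B"
    unfolding scaleR_scaleC z_def using v(1)
    by (intro complex_vector.span_scale complex_vector.span_diff)
  moreover have "z /\<^sub>R norm z \<notin> W"
  proof
    assume "z /\<^sub>R norm z \<in> W"
    from perp[OF this] have "cinner z z = 0" using z by (simp add: cinner_scaleR_left)
    then show False using z by (simp add: cinner_self)
  qed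
  ultimately show ?case
    using W orthonormal_insert[OF W(3) z perp]
    by (intro exI[of _ "insert (z /\<^sub>R norm z) W"]) simp
qed

section \<open>Projection-valued measures\<close>

locale pvm =
  fixes E :: "real set \<Rightarrow> 'a::{complex_inner,banach} \<Rightarrow> 'a"
  assumes pvm: "projection_valued_measure E"
begin

lemma proj: "B \<in> sets borel \<Longrightarrow> orthogonal_projection (E B)"
  using pvm by (simp add: projection_valued_measure_def)

lemma linear: "B \<in> sets borel \<Longrightarrow> bounded_linear (E B)"
  using proj by (simp add: orthogonal_projection_iff)

lemma symmetric: "B \<in> sets borel \<Longrightarrow> cinner (E B f) g = cinner f (E B g)"
  using proj by (simp add: orthogonal_projection_iff)

lemma scaleC: "B \<in> sets borel \<Longrightarrow> E B (c *\<^sub>C f) = c *\<^sub>C E B f"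
  by (rule symmetric_scaleC) (rule symmetric)

lemma add: "B \<in> sets borel \<Longrightarrow> E B (f + g) = E B f + E B g"
  using linear by (simp add: linear_simps)

lemma empty [simp]: "E {} f = 0"
  using pvm by (simp add: projection_valued_measure_def)

lemma UNIV [simp]: "E UNIV f = f"
  using pvm by (simp add: projection_valued_measure_def)

lemma Int: "B \<in> sets borel \<Longrightarrow> C \<in> sets borel \<Longrightarrow> E B (E C f) = E (B \<inter> C) f"
  using pvm by (simp add: projection_valued_measure_def)

lemma sums: "range B \<subseteq> sets borel \<Longrightarrow> disjoint_family B \<Longrightarrow> (\<lambda>n. E (B n) f) sums E (\<Union>n. B n) f"
  using pvm unfolding projection_valued_measure_def by blast

lemma Un:
  assumes "B \<in> sets borel" "C \<in> sets borel" "B \<inter> C = {}"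
  shows "E (B \<union> C) f = E B f + E C f"
proof -
  have "range (binaryset B C) \<subseteq> sets borel" "disjoint_family (binaryset B C)"
    using assms by (auto simp: range_binaryset_eq disjoint_family_on_def binaryset_def)
  from sums[OF this] have "(\<lambda>n. E (binaryset B C n) f) sums E (B \<union> C) f"
    by (simp add: UN_binaryset_eq)
  moreover have "(\<lambda>n. E (binaryset B C n) f) sums (E B f + E C f)"
    unfolding sums_def using LIMSEQ_binaryset[of "\<lambda>X. E X f" B C] by simp
  ultimately show ?thesis by (rule sums_unique2)
qed

lemma Compl: "B \<in> sets borel \<Longrightarrow> E (- B) f = f - E B f"
  using Un[of B "- B" f] borel_comp[of B] by (simp add: eq_diff_eq add.commute)

lemma cinner_E_E:
  assumes "B \<in> sets borel" "C \<in> sets borel"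
  shows "cinner (E B f) (E C f) = of_real ((norm (E (B \<inter> C) f))\<^sup>2)"
  using orthogonal_projection_cinner_self[OF proj, of "B \<inter> C" f] assms
  by (simp add: symmetric Int del: of_real_power)

section \<open>Scalar spectral measures\<close>

lemma sets_scalar_measure [simp]: "sets (scalar_measure E f) = sets borel"
  unfolding scalar_measure_def
  using sets.sets_measure_of_eq[of "borel :: real measure"] by (simp only: space_borel)

lemma space_scalar_measure [simp]: "space (scalar_measure E f) = UNIV"
  unfolding scalar_measure_def
  using sets.space_measure_of_eq[of "borel :: real measure"] by (simp only: space_borel)

lemma measurable_scalar_measure [simp]: "measurable (scalar_measure E f) N = measurable borel N"
  by (rule measurable_cong_sets) simp_all

text \<open>\<open>measure_of\<close> returns the given set function once that is known to be
  countably additive. This comes from pairing the strongly convergent series for \<open>E\<close>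
  with \<open>f\<close>; idempotence and symmetry turn the form into a squared norm.\<close>

lemma emeasure_scalar_measure:
  assumes "B \<in> sets borel"
  shows "emeasure (scalar_measure E f) B = ennreal ((norm (E B f))\<^sup>2)"
proof -
  have eq: "Re (cinner f (E B f)) = (norm (E B f))\<^sup>2" if "B \<in> sets borel" for B
    using orthogonal_projection_cinner_self[OF proj[OF that]] by simp
  have "emeasure (scalar_measure E f) B = ennreal (Re (cinner f (E B f)))"
    unfolding scalar_measure_def
  proof (rule emeasure_measure_of_sigma[OF _ _ _ assms])
    show "sigma_algebra UNIV (sets (borel :: real measure))"
      using sets.sigma_algebra_axioms[of "borel :: real measure"] by simp
    show "positive (sets borel) (\<lambda>B. ennreal (Re (cinner f (E B f))))"
      by (simp add: positive_def)
    show "countably_additive (sets borel) (\<lambda>B. ennreal (Re (cinner f (E B f))))"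
    proof (rule countably_additiveI)
      fix B :: "nat \<Rightarrow> real set"
      assume B: "range B \<subseteq> sets borel" "disjoint_family B"
      have "(\<lambda>n. inner f (E (B n) f)) sums inner f (E (\<Union>n. B n) f)"
        by (rule bounded_linear.sums[OF bounded_linear_inner_right sums[OF B]])
      then have s: "(\<lambda>n. Re (cinner f (E (B n) f))) sums Re (cinner f (E (\<Union>n. B n) f))"
        by (simp add: inner_eq_Re_cinner)
      have "0 \<le> Re (cinner f (E (B n) f))" for n
        using B(1) by (subst eq) auto
      then show "(\<Sum>n. ennreal (Re (cinner f (E (B n) f)))) = ennreal (Re (cinner f (E (\<Union>n. B n) f)))"
        by (rule suminf_ennreal_eq[OF _ s])
    qed
  qed
  then show ?thesis by (simp add: eq[OF assms])
qed

lemma measure_scalar_measure: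
  "B \<in> sets borel \<Longrightarrow> measure (scalar_measure E f) B = (norm (E B f))\<^sup>2"
  by (simp add: measure_def emeasure_scalar_measure)

lemma finite_measure_scalar_measure: "finite_measure (scalar_measure E f)"
  by (rule finite_measureI) (simp add: emeasure_scalar_measure)

lemma scalar_measure_E:
  assumes C: "C \<in> sets borel"
  shows "scalar_measure E (E C f) = density (scalar_measure E f) (indicator C)"
proof (rule measure_eqI)
  fix B assume "B \<in> sets (scalar_measure E (E C f))"
  then have B: "B \<in> sets borel" by simp
  have "emeasure (density (scalar_measure E f) (indicator C)) B =
      (\<integral>\<^sup>+ x. indicator (B \<inter> C) x \<partial>scalar_measure E f)"
    using B C by (simp add: emeasure_density indicator_inter_arith mult.commute)
  also have "\<dots> = emeasure (scalar_measure E f) (B \<inter> C)"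
    using B C by (intro nn_integral_indicator) simp
  finally show "emeasure (scalar_measure E (E C f)) B =
      emeasure (density (scalar_measure E f) (indicator C)) B"
    using B C by (simp add: emeasure_scalar_measure Int)
qed simp

lemma integral_scalar_measure_E:
  fixes \<phi> :: "real \<Rightarrow> real"
  assumes "C \<in> sets borel" "\<phi> \<in> borel_measurable borel"
  shows "(\<integral>t. \<phi> t \<partial>scalar_measure E (E C f)) = (\<integral>t. \<phi> t * indicator C t \<partial>scalar_measure E f)"
proof -
  have "indicator C = (\<lambda>t. ennreal (indicator C t))" by (auto simp: indicator_def)
  then show ?thesis
    using assms by (simp add: scalar_measure_E integral_density mult.commute)
qed

section \<open>Domains of the functional calculus\<close>

lemma nn_integral_scalar_measure_scaleC:
  assumes "u \<in> borel_measurable borel"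
  shows "(\<integral>\<^sup>+ t. u t \<partial>scalar_measure E (c *\<^sub>C f)) =
    ennreal ((cmod c)\<^sup>2) * (\<integral>\<^sup>+ t. u t \<partial>scalar_measure E f)"
proof -
  have "scalar_measure E (c *\<^sub>C f) = scale_measure (ennreal ((cmod c)\<^sup>2)) (scalar_measure E f)"
    by (rule measure_eqI)
       (simp_all add: emeasure_scalar_measure scaleC norm_scaleC power_mult_distrib ennreal_mult)
  then show ?thesis using assms by (simp add: nn_integral_scale_measure)
qed

text \<open>The scalar measure is quadratic in the vector, not additive, but
  \<open>|a + b|^2 <= 2 |a|^2 + 2 |b|^2\<close> compares the measures set by set. The comparison
  passes to simple functions and their supremum; it is what closes the domain under
  addition.\<close>

lemma nn_integral_scalar_measure_add_le:
  "(\<integral>\<^sup>+ t. u t \<partial>scalar_measure E (f + g)) \<le>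
    2 * (\<integral>\<^sup>+ t. u t \<partial>scalar_measure E f) + 2 * (\<integral>\<^sup>+ t. u t \<partial>scalar_measure E g)"
  unfolding nn_integral_def[of "scalar_measure E (f + g)"]
proof (rule SUP_least)
  fix s assume "s \<in> {s. simple_function (scalar_measure E (f + g)) s \<and> s \<le> u}"
  then have s: "simple_function (scalar_measure E (f + g)) s" and le: "s \<le> u" by auto
  have s': "simple_function (scalar_measure E h) s" for h
    by (rule simple_function_cong_algebra[THEN iffD1, OF _ _ s]) simp_all
  have B: "s -` {y} \<in> sets borel" for y
    using simple_functionD(2)[OF s, of "{y}"] by simp
  have em: "emeasure (scalar_measure E (f + g)) C \<le>
     2 * emeasure (scalar_measure E f) C + 2 * emeasure (scalar_measure E g) C"
    if "C \<in> sets borel" for C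
  proof -
    have "ennreal ((norm (E C (f + g)))\<^sup>2) \<le> ennreal (2 * (norm (E C f))\<^sup>2 + 2 * (norm (E C g))\<^sup>2)"
      using that by (intro ennreal_leI) (simp add: add norm_add_power2_le)
    then show ?thesis using that by (simp add: emeasure_scalar_measure ennreal_mult)
  qed
  have "simple_integral (scalar_measure E (f + g)) s \<le>
     2 * simple_integral (scalar_measure E f) s + 2 * simple_integral (scalar_measure E g) s"
  proof -
    have "(\<Sum>y\<in>range s. y * emeasure (scalar_measure E (f + g)) (s -` {y})) \<le>
      (\<Sum>y\<in>range s. y * (2 * emeasure (scalar_measure E f) (s -` {y}) +
         2 * emeasure (scalar_measure E g) (s -` {y})))"
      by (intro sum_mono mult_left_mono em B) simp
    then show ?thesis
      by (simp add: simple_integral_def sum_distrib_left distrib_left sum.distrib mult.left_commute)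
  qed
  also have "\<dots> \<le> 2 * (\<integral>\<^sup>+ t. u t \<partial>scalar_measure E f) + 2 * (\<integral>\<^sup>+ t. u t \<partial>scalar_measure E g)"
    using le by (intro add_mono mult_left_mono)
      (simp_all add: nn_integral_eq_simple_integral[OF s', symmetric] nn_integral_mono le_funD)
  finally show "simple_integral (scalar_measure E (f + g)) s \<le>
    2 * (\<integral>\<^sup>+ t. u t \<partial>scalar_measure E f) + 2 * (\<integral>\<^sup>+ t. u t \<partial>scalar_measure E g)" .
qed

lemma fcalc_dom_subspace:
  assumes "\<phi> \<in> borel_measurable borel"
  shows "complex_vector.subspace (fcalc_dom E \<phi>)"
proof (rule complex_vector.subspaceI)
  have [measurable]: "\<phi> \<in> borel_measurable borel" by fact
  show scale: "c *\<^sub>C f \<in> fcalc_dom E \<phi>" if "f \<in> fcalc_dom E \<phi>" for c f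
    using that by (simp add: fcalc_dom_def nn_integral_scalar_measure_scaleC ennreal_mult_less_top)
  show "f + g \<in> fcalc_dom E \<phi>" if "f \<in> fcalc_dom E \<phi>" "g \<in> fcalc_dom E \<phi>" for f g
    using that unfolding fcalc_dom_def
    by (auto intro!: le_less_trans[OF nn_integral_scalar_measure_add_le] simp: ennreal_mult_less_top)
  have "(\<integral>\<^sup>+ t. ennreal ((\<phi> t)\<^sup>2) \<partial>scalar_measure E (0 *\<^sub>C 0)) = 0"
    by (subst nn_integral_scalar_measure_scaleC) auto
  then show "0 \<in> fcalc_dom E \<phi>"
    by (simp add: fcalc_dom_def)
qed

lemma E_in_fcalc_dom:
  assumes C: "C \<in> sets borel" and \<phi> [measurable]: "\<phi> \<in> borel_measurable borel"
    and f: "f \<in> fcalc_dom E \<phi>"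
  shows "E C f \<in> fcalc_dom E \<phi>"
proof -
  have "(\<integral>\<^sup>+ t. ennreal ((\<phi> t)\<^sup>2) \<partial>scalar_measure E (E C f)) \<le>
      (\<integral>\<^sup>+ t. ennreal ((\<phi> t)\<^sup>2) \<partial>scalar_measure E f)"
    using C by (simp add: scalar_measure_E nn_integral_density)
       (auto intro!: nn_integral_mono simp: indicator_def)
  then show ?thesis using f by (auto simp: fcalc_dom_def)
qed

text \<open>Produces domain vectors from arbitrary ones: after a cut-off to a set where
  \<open>\<phi>\<close> is bounded, the finite total mass of the scalar measure suffices.\<close>

lemma E_in_fcalc_dom_bounded:
  assumes C: "C \<in> sets borel" and \<phi> [measurable]: "\<phi> \<in> borel_measurable borel"
    and bound: "\<And>t. t \<in> C \<Longrightarrow> \<bar>\<phi> t\<bar> \<le> K"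
  shows "E C f \<in> fcalc_dom E \<phi>"
proof -
  have "(\<phi> t)\<^sup>2 \<le> K\<^sup>2" if "t \<in> C" for t
    using power_mono[OF bound[OF that], of 2] by simp
  then have "(\<integral>\<^sup>+ t. indicator C t * ennreal ((\<phi> t)\<^sup>2) \<partial>scalar_measure E f) \<le>
      (\<integral>\<^sup>+ t. ennreal (K\<^sup>2) \<partial>scalar_measure E f)"
    by (intro nn_integral_mono) (auto intro: ennreal_leI simp: indicator_def)
  also have "\<dots> < \<infinity>"
    by (simp add: emeasure_scalar_measure ennreal_mult_less_top)
  finally show ?thesis
    using C by (simp add: fcalc_dom_def scalar_measure_E nn_integral_density)
qed

lemma fcalc_dom_integrable_power2:
  assumes \<phi> [measurable]: "\<phi> \<in> borel_measurable borel" and f: "f \<in> fcalc_dom E \<phi>"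
  shows "integrable (scalar_measure E f) (\<lambda>t. (\<phi> t)\<^sup>2)"
  using f by (intro integrableI_bounded) (auto simp: fcalc_dom_def)

lemma fcalc_dom_integrable:
  assumes \<phi> [measurable]: "\<phi> \<in> borel_measurable borel" and f: "f \<in> fcalc_dom E \<phi>"
  shows "integrable (scalar_measure E f) \<phi>"
proof (rule Bochner_Integration.integrable_bound)
  interpret finite_measure "scalar_measure E f" by (rule finite_measure_scalar_measure)
  show "integrable (scalar_measure E f) (\<lambda>t. 1 + (\<phi> t)\<^sup>2)"
    using fcalc_dom_integrable_power2[OF assms] by simp
  have "\<bar>r\<bar> \<le> 1 + r\<^sup>2" for r :: real
    using zero_le_power2[of "\<bar>r\<bar> - 1"] zero_le_power2[of r] by (simp add: power2_diff)
  then show "AE t in scalar_measure E f. norm (\<phi> t) \<le> norm (1 + (\<phi> t)\<^sup>2)"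
    by (intro AE_I2) (simp add: add_nonneg_nonneg)
qed simp

text \<open>The spectral integral of a simple function. The isometry property makes the integrals of an
  approximating sequence Cauchy, which yields the integral of an arbitrary Borel function.\<close>

definition simple_op :: "(real \<Rightarrow> real) \<Rightarrow> 'a \<Rightarrow> 'a" where
  "simple_op s f = (\<Sum>y\<in>range s. y *\<^sub>R E (s -` {y}) f)"

text \<open>The integrand is constant on intersections of level sets of \<open>s\<close> and
  \<open>t\<close>, and \<open>cinner_E_E\<close> identifies the pairing of two spectral pieces with
  the mass of such an intersection.\<close>

lemma cinner_simple_op:
  assumes "simple_function borel s" "simple_function borel t"
  shows "cinner (simple_op s f) (simple_op t f) = of_real (\<integral>x. s x * t x \<partial>scalar_measure E f)"
proof -
  have fin: "finite (range s)" "finite (range t)"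
    using assms by (auto dest: simple_functionD(1))
  have meas: "s -` {y} \<in> sets borel" "t -` {y} \<in> sets borel" for y
    using simple_functionD(2)[OF assms(1), of "{y}"] simple_functionD(2)[OF assms(2), of "{y}"] by auto
  interpret finite_measure "scalar_measure E f" by (rule finite_measure_scalar_measure)
  have "s x * t x = (\<Sum>y\<in>range s. \<Sum>z\<in>range t. y * z * indicator (s -` {y} \<inter> t -` {z}) x)" for x
  proof -
    have "(\<Sum>y\<in>range s. \<Sum>z\<in>range t. y * z * indicator (s -` {y} \<inter> t -` {z}) x) =
       (\<Sum>y\<in>range s. if y = s x then (\<Sum>z\<in>range t. if z = t x then y * z else 0) else 0)"
      by (intro sum.cong refl) (auto intro!: sum.cong sum.neutral simp: indicator_def)
    also have "\<dots> = s x * t x" using fin by (simp add: sum.delta)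
    finally show ?thesis by simp
  qed
  then have "(\<integral>x. s x * t x \<partial>scalar_measure E f) =
     (\<integral>x. (\<Sum>y\<in>range s. \<Sum>z\<in>range t. y * z * indicator (s -` {y} \<inter> t -` {z}) x) \<partial>scalar_measure E f)"
    by simp
  also have "\<dots> = (\<Sum>y\<in>range s. \<Sum>z\<in>range t. y * z * measure (scalar_measure E f) (s -` {y} \<inter> t -` {z}))"
    using meas by (simp add: Bochner_Integration.integral_sum integrable_real_indicator less_top[symmetric])
  also have "\<dots> = (\<Sum>y\<in>range s. \<Sum>z\<in>range t. y * z * (norm (E (s -` {y} \<inter> t -` {z}) f))\<^sup>2)"
    using meas by (simp add: measure_scalar_measure)
  also have "of_real \<dots> = cinner (simple_op s f) (simple_op t f)"
    unfolding simple_op_def cinner_sum_left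
    unfolding cinner_sum_right of_real_sum
    using meas by (intro sum.cong refl)
      (simp add: cinner_scaleR_left cinner_scaleR_right cinner_E_E)
  finally show ?thesis by simp
qed

lemma norm_simple_op_diff:
  assumes s: "simple_function borel s" and t: "simple_function borel t"
  shows "(norm (simple_op s f - simple_op t f))\<^sup>2 = (\<integral>x. (s x - t x)\<^sup>2 \<partial>scalar_measure E f)"
proof -
  have int: "integrable (scalar_measure E f) (\<lambda>x. s x * t x)"
    if "simple_function borel s" "simple_function borel t" for s t :: "real \<Rightarrow> real"
  proof -
    interpret finite_measure "scalar_measure E f" by (rule finite_measure_scalar_measure)
    have "simple_function borel (\<lambda>x. s x * t x)"
      using that by (intro simple_function_mult)
    then have "simple_function (scalar_measure E f) (\<lambda>x. s x * t x)"
      by (rule simple_function_cong_algebra[THEN iffD1, rotated 2]) simp_all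
    then show ?thesis
      by (intro integrable_simple_function) (simp_all add: less_top[symmetric])
  qed
  have "cinner (simple_op s f - simple_op t f) (simple_op s f - simple_op t f) =
     of_real (\<integral>x. s x * s x \<partial>scalar_measure E f) - of_real (\<integral>x. s x * t x \<partial>scalar_measure E f)
     - (of_real (\<integral>x. t x * s x \<partial>scalar_measure E f) - of_real (\<integral>x. t x * t x \<partial>scalar_measure E f))"
    using s t by (simp add: cinner_diff_left cinner_diff_right cinner_simple_op)
  also have "\<dots> = of_real ((\<integral>x. (s x * s x - s x * t x) - (t x * s x - t x * t x) \<partial>scalar_measure E f))"
    using int[OF s s] int[OF s t] int[OF t s] int[OF t t] by (simp add: mult.commute)
  finally have "(norm (simple_op s f - simple_op t f))\<^sup>2 =
      (\<integral>x. (s x * s x - s x * t x) - (t x * s x - t x * t x) \<partial>scalar_measure E f)"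
    by (simp only: cinner_self of_real_eq_iff)
  also have "\<dots> = (\<integral>x. (s x - t x)\<^sup>2 \<partial>scalar_measure E f)"
    by (intro Bochner_Integration.integral_cong refl) (simp add: power2_eq_square algebra_simps)
  finally show ?thesis .
qed

lemma cinner_simple_op_form:
  assumes s: "simple_function borel s"
  shows "cinner f (simple_op s f) = of_real (\<integral>x. s x \<partial>scalar_measure E f)"
proof -
  have "simple_op (\<lambda>_. 1) f = f" by (simp add: simple_op_def)
  then show ?thesis
    using cinner_simple_op[OF _ s, of "\<lambda>_. 1" f] by simp
qed

lemma simple_op_add: "simple_function borel s \<Longrightarrow> simple_op s (f + g) = simple_op s f + simple_op s g"
  using simple_functionD(2)[of borel s]
  by (simp add: simple_op_def add sum.distrib scaleR_add_right)

lemma simple_op_scaleC: "simple_function borel s \<Longrightarrow> simple_op s (c *\<^sub>C f) = c *\<^sub>C simple_op s f"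
  using simple_functionD(2)[of borel s]
  by (simp add: simple_op_def scaleC complex_vector.scale_sum_right scaleR_scaleC scaleC_scaleC mult.commute)

lemma spectral_integral_exists:
  assumes \<phi> [measurable]: "\<phi> \<in> borel_measurable borel"
  shows "\<exists>T. is_spectral_integral E \<phi> (fcalc_dom E \<phi>) T"
proof -
  \<comment> \<open>The bound by \<open>2 * \<bar>\<phi> x\<bar>\<close> makes the squared errors at
    most \<open>9 * (\<phi> x)^2\<close>, integrable because \<open>f\<close> lies in the domain;
    dominated convergence then makes the images Cauchy.\<close>
  obtain S :: "nat \<Rightarrow> real \<Rightarrow> real" where S: "\<And>n. simple_function borel (S n)"
    "\<And>x. (\<lambda>n. S n x) \<longlonglongrightarrow> \<phi> x" "\<And>n x. \<bar>S n x\<bar> \<le> 2 * \<bar>\<phi> x\<bar>"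
    using borel_measurable_implies_sequence_metric[OF \<phi>, of 0] by (auto simp: dist_norm)
  have [measurable]: "S n \<in> borel_measurable borel" for n
    using S(1) by (rule borel_measurable_simple_function)
  define T where "T f = lim (\<lambda>n. simple_op (S n) f)" for f
  have conv: "(\<lambda>n. simple_op (S n) f) \<longlonglongrightarrow> T f" if f: "f \<in> fcalc_dom E \<phi>" for f
  proof -
    let ?M = "scalar_measure E f"
    have int2: "integrable ?M (\<lambda>t. (\<phi> t)\<^sup>2)" by (rule fcalc_dom_integrable_power2[OF \<phi> f])
    have bound: "(S n x - \<phi> x)\<^sup>2 \<le> 9 * (\<phi> x)\<^sup>2" for n x
    proof -
      have "\<bar>S n x - \<phi> x\<bar> \<le> 3 * \<bar>\<phi> x\<bar>" using S(3)[of n x] by linarith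
      then have "\<bar>S n x - \<phi> x\<bar>\<^sup>2 \<le> (3 * \<bar>\<phi> x\<bar>)\<^sup>2" by (intro power_mono) auto
      then show ?thesis by (simp add: power_mult_distrib)
    qed
    have int: "integrable ?M (\<lambda>x. (S n x - \<phi> x)\<^sup>2)" for n
      by (rule Bochner_Integration.integrable_bound[where f = "\<lambda>t. 9 * (\<phi> t)\<^sup>2"])
         (use int2 bound in \<open>auto simp: abs_of_nonneg\<close>)
    have lim: "(\<lambda>n. \<integral>x. (S n x - \<phi> x)\<^sup>2 \<partial>?M) \<longlonglongrightarrow> (\<integral>x. 0 \<partial>?M)"
    proof (rule integral_dominated_convergence[where w = "\<lambda>t. 9 * (\<phi> t)\<^sup>2"])
      have "(\<lambda>n. (S n x - \<phi> x)\<^sup>2) \<longlonglongrightarrow> (\<phi> x - \<phi> x)\<^sup>2" for x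
        by (intro tendsto_intros S)
      then show "AE x in ?M. (\<lambda>n. (S n x - \<phi> x)\<^sup>2) \<longlonglongrightarrow> 0" by simp
    qed (use int2 bound in auto)
    have diff: "(norm (simple_op (S m) f - simple_op (S n) f))\<^sup>2 \<le>
       2 * (\<integral>x. (S m x - \<phi> x)\<^sup>2 \<partial>?M) + 2 * (\<integral>x. (S n x - \<phi> x)\<^sup>2 \<partial>?M)" for m n
    proof -
      have le: "(S m x - S n x)\<^sup>2 \<le> 2 * (S m x - \<phi> x)\<^sup>2 + 2 * (S n x - \<phi> x)\<^sup>2" for x
        using norm_add_power2_le[of "S m x - \<phi> x" "\<phi> x - S n x"] by (simp add: power2_commute)
      have "(\<integral>x. (S m x - S n x)\<^sup>2 \<partial>?M) \<le> (\<integral>x. 2 * (S m x - \<phi> x)\<^sup>2 + 2 * (S n x - \<phi> x)\<^sup>2 \<partial>?M)"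
      proof (rule integral_mono)
        show "integrable ?M (\<lambda>x. 2 * (S m x - \<phi> x)\<^sup>2 + 2 * (S n x - \<phi> x)\<^sup>2)" using int by simp
        then show "integrable ?M (\<lambda>x. (S m x - S n x)\<^sup>2)"
          by (rule Bochner_Integration.integrable_bound) (use le in \<open>auto intro!: AE_I2 order_trans[OF le]\<close>)
      qed (rule le)
      then show ?thesis using int by (simp add: norm_simple_op_diff S(1))
    qed
    have "Cauchy (\<lambda>n. simple_op (S n) f)"
    proof (rule metric_CauchyI)
      fix e :: real assume e: "0 < e"
      then have "0 < e\<^sup>2 / 4" by simp
      from order_tendstoD(2)[OF lim, of "e\<^sup>2 / 4"] this
      obtain N where N: "\<And>n. n \<ge> N \<Longrightarrow> (\<integral>x. (S n x - \<phi> x)\<^sup>2 \<partial>?M) < e\<^sup>2 / 4"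
        by (auto simp: eventually_sequentially)
      have "dist (simple_op (S m) f) (simple_op (S n) f) < e" if "m \<ge> N" "n \<ge> N" for m n
      proof -
        have "(norm (simple_op (S m) f - simple_op (S n) f))\<^sup>2 < e\<^sup>2"
          using diff[of m n] N[OF that(1)] N[OF that(2)] by linarith
        then show ?thesis using e by (simp add: dist_norm power2_less_imp_less)
      qed
      then show "\<exists>M. \<forall>m\<ge>M. \<forall>n\<ge>M. dist (simple_op (S m) f) (simple_op (S n) f) < e" by blast
    qed
    then show ?thesis
      unfolding T_def by (simp add: Cauchy_convergent_iff convergent_LIMSEQ_iff)
  qed
  note sub = fcalc_dom_subspace[OF \<phi>]
  have "T (f + g) = T f + T g" if f: "f \<in> fcalc_dom E \<phi>" and g: "g \<in> fcalc_dom E \<phi>" for f g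
    using LIMSEQ_unique[OF conv[OF complex_vector.subspace_add[OF sub f g]]]
      tendsto_add[OF conv[OF f] conv[OF g]] by (simp add: simple_op_add S(1))
  moreover have "T (c *\<^sub>C f) = c *\<^sub>C T f" if f: "f \<in> fcalc_dom E \<phi>" for c f
    using LIMSEQ_unique[OF conv[OF complex_vector.subspace_scale[OF sub f]]]
      bounded_linear.tendsto[OF bounded_linear_scaleC conv[OF f]] by (simp add: simple_op_scaleC S(1))
  moreover have "cinner f (T f) = of_real (\<integral>t. \<phi> t \<partial>scalar_measure E f)" if f: "f \<in> fcalc_dom E \<phi>" for f
  proof -
    have "(\<lambda>n. \<integral>x. S n x \<partial>scalar_measure E f) \<longlonglongrightarrow> (\<integral>x. \<phi> x \<partial>scalar_measure E f)"
      by (rule integral_dominated_convergence[where w = "\<lambda>t. 2 * \<bar>\<phi> t\<bar>"])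
         (use fcalc_dom_integrable[OF \<phi> f] S in auto)
    then have "(\<lambda>n. cinner f (simple_op (S n) f)) \<longlonglongrightarrow> of_real (\<integral>x. \<phi> x \<partial>scalar_measure E f)"
      by (simp add: cinner_simple_op_form S(1) tendsto_of_real)
    then show ?thesis
      using LIMSEQ_unique tendsto_cinner[OF tendsto_const conv[OF f]] by blast
  qed
  ultimately show ?thesis
    by (intro exI[of _ T]) (simp add: is_spectral_integral_def linear_operator_def sub)
qed

lemma fcalc_is_spectral_integral:
  "\<phi> \<in> borel_measurable borel \<Longrightarrow> is_spectral_integral E \<phi> (fcalc_dom E \<phi>) (fcalc E \<phi>)"
  unfolding fcalc_def by (rule someI_ex[OF spectral_integral_exists])

text \<open>The form of \<open>\<integral> \<phi> dE\<close> has no cross terms between the ranges of \<open>E C\<close> and \<open>E (- C)\<close>.\<close>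

lemma cinner_E_spectral_integral:
  assumes T: "is_spectral_integral E \<phi> D T" and \<phi> [measurable]: "\<phi> \<in> borel_measurable borel"
    and C: "C \<in> sets borel" and h: "h \<in> D"
  shows "cinner (E C h) (T h) = of_real (\<integral>t. \<phi> t * indicator C t \<partial>scalar_measure E h)"
proof -
  have D: "D = fcalc_dom E \<phi>" and lin: "linear_operator D T"
    and form: "\<And>f. f \<in> D \<Longrightarrow> cinner f (T f) = of_real (\<integral>t. \<phi> t \<partial>scalar_measure E f)"
    using T by (auto simp: is_spectral_integral_def)
  have Tadd: "T (f + g) = T f + T g" if "f \<in> D" "g \<in> D" for f g
    using lin that by (auto simp: linear_operator_def)
  have Tscale: "T (c *\<^sub>C f) = c *\<^sub>C T f" if "f \<in> D" for c f
    using lin that by (auto simp: linear_operator_def)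
  have sub: "complex_vector.subspace D" using lin by (auto simp: linear_operator_def)
  have C': "- C \<in> sets borel" using borel_comp[OF C] .
  define f g where "f = E C h" and "g = E (- C) h"
  have fD: "f \<in> D" and gD: "g \<in> D"
    using E_in_fcalc_dom[OF _ \<phi>, of _ h] h C C' by (auto simp: D f_def g_def)
  have hfg: "h = f + g" using Compl[OF C, of h] by (simp add: f_def g_def)
  \<comment> \<open>The scalar measure of \<open>f + c g\<close> splits over \<open>C\<close> and
    \<open>- C\<close> into those of \<open>f\<close> and \<open>c g\<close>, so its form is the sum
    of the two separate forms; expanding sesquilinearly, the cross terms must cancel.\<close>
  have cross: "c * cinner f (T g) + cnj c * cinner g (T f) = 0" for c
  proof -
    define k where "k = f + c *\<^sub>C g"
    have cg: "c *\<^sub>C g \<in> D" by (rule complex_vector.subspace_scale[OF sub gD])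
    have kD: "k \<in> D" unfolding k_def by (rule complex_vector.subspace_add[OF sub fD cg])
    have Ek: "E C k = f" "E (- C) k = c *\<^sub>C g"
      using C C' by (simp_all add: k_def f_def g_def add scaleC Int)
    have "cinner k (T k) = of_real (\<integral>t. \<phi> t \<partial>scalar_measure E k)" by (rule form[OF kD])
    also have "(\<integral>t. \<phi> t \<partial>scalar_measure E k) =
        (\<integral>t. \<phi> t * indicator C t + \<phi> t * indicator (- C) t \<partial>scalar_measure E k)"
      by (intro Bochner_Integration.integral_cong refl) (auto simp: indicator_def)
    also have "\<dots> = (\<integral>t. \<phi> t * indicator C t \<partial>scalar_measure E k) +
        (\<integral>t. \<phi> t * indicator (- C) t \<partial>scalar_measure E k)"
      using fcalc_dom_integrable[OF \<phi>, of k] kD C C'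
      by (intro Bochner_Integration.integral_add integrable_real_mult_indicator) (simp_all add: D)
    also have "\<dots> = (\<integral>t. \<phi> t \<partial>scalar_measure E f) + (\<integral>t. \<phi> t \<partial>scalar_measure E (c *\<^sub>C g))"
      using C C' by (simp add: integral_scalar_measure_E[symmetric] Ek)
    also have "of_real \<dots> = cinner f (T f) + cinner (c *\<^sub>C g) (T (c *\<^sub>C g))"
      using form[OF fD] form[OF cg] by simp
    finally show ?thesis
      using fD gD cg by (simp add: k_def Tadd Tscale cinner_add_left cinner_add_right
          cinner_scaleC_left cinner_scaleC_right algebra_simps)
  qed
  \<comment> \<open>\<open>c = 1\<close> and \<open>c = \<i>\<close> say that the two cross terms
    have zero sum and zero difference.\<close>
  have "cinner f (T g) = 0"
    using cross[of 1] cross[of \<i>] by (simp add: complex_eq_iff)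
  then have "cinner f (T h) = cinner f (T f)"
    using Tadd[OF fD gD] by (simp add: hfg cinner_add_right)
  also have "\<dots> = of_real (\<integral>t. \<phi> t * indicator C t \<partial>scalar_measure E h)"
    using form[OF fD] integral_scalar_measure_E[OF C \<phi>, of h] by (simp add: f_def)
  finally show ?thesis by (simp add: f_def)
qed

section \<open>Spectral lower bounds for the square root\<close>

lemma E_union_eq_zero:
  assumes "\<And>n::nat. B n \<in> sets borel" "\<And>n. E (B n) f = 0"
  shows "E (\<Union>n. B n) f = 0"
proof -
  have "(\<Union>n. B n) \<in> null_sets (scalar_measure E f)"
    using assms by (intro null_sets_UN) (simp add: null_sets_def emeasure_scalar_measure)
  then show ?thesis
    using assms by (auto simp: null_sets_def emeasure_scalar_measure)
qed

text \<open>Only the form is at hand, so \<open>fcalc E sqrt h\<close> is paired with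
  \<open>E {l<..} h\<close>. The integral of \<open>sqrt t\<close> over \<open>t > l\<close> is at
  least \<open>sqrt l\<close> times the squared norm of the projected vector, and Cauchy-Schwarz
  bounds it by the product of norms; one factor cancels.\<close>

lemma norm_E_le_fcalc_sqrt:
  assumes h: "h \<in> fcalc_dom E sqrt" and l: "0 \<le> l"
  shows "l * (norm (E {l<..} h))\<^sup>2 \<le> (norm (fcalc E sqrt h))\<^sup>2"
proof -
  let ?P = "E {l<..} h" and ?T = "fcalc E sqrt h" and ?M = "scalar_measure E h"
  interpret finite_measure ?M by (rule finite_measure_scalar_measure)
  have sq: "sqrt \<in> borel_measurable borel" by simp
  have "sqrt l * (norm ?P)\<^sup>2 = (\<integral>t. sqrt l * indicator {l<..} t \<partial>?M)"
    by (simp add: measure_scalar_measure)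
  also have "\<dots> \<le> (\<integral>t. sqrt t * indicator {l<..} t \<partial>?M)"
    using fcalc_dom_integrable[OF sq h]
    by (intro integral_mono integrable_real_mult_indicator)
       (auto simp: indicator_def integrable_real_indicator less_top[symmetric] intro!: integrable_real_mult_indicator)
  also have "\<dots> = Re (cinner ?P ?T)"
    using cinner_E_spectral_integral[OF fcalc_is_spectral_integral[OF sq] sq _ h, of "{l<..}"] by simp
  also have "\<dots> \<le> norm ?P * norm ?T"
    using complex_Cauchy_Schwarz complex_Re_le_cmod order_trans by blast
  finally have "norm ?P * (sqrt l * norm ?P) \<le> norm ?P * norm ?T"
    by (simp add: power2_eq_square mult_ac)
  then have "sqrt l * norm ?P \<le> norm ?T"
    by (cases "?P = 0") auto
  then have "(sqrt l * norm ?P)\<^sup>2 \<le> (norm ?T)\<^sup>2"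
    using l by (intro power_mono) auto
  then show ?thesis using l by (simp add: power_mult_distrib)
qed

text \<open>At \<open>l = 0\<close> the preceding bound is empty, so the open half-line is exhausted
  by \<open>{inverse (real (Suc n))<..}\<close>, on each of which the bound forces the spectral part
  to vanish.\<close>

lemma fcalc_sqrt_eq_zero:
  assumes h: "h \<in> fcalc_dom E sqrt" and T: "fcalc E sqrt h = 0"
  shows "E {0<..} h = 0"
proof -
  have "E {inverse (real (Suc n))<..} h = 0" for n
    using norm_E_le_fcalc_sqrt[OF h, of "inverse (real (Suc n))"] T
    by (simp add: mult_le_0_iff del: of_nat_Suc)
  then have "E (\<Union>n. {inverse (real (Suc n))<..}) h = 0"
    by (intro E_union_eq_zero) auto
  moreover have "(\<Union>n. {inverse (real (Suc n))<..}) = {0<..}"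
  proof (intro equalityI subsetI)
    fix t :: real assume "t \<in> (\<Union>n. {inverse (real (Suc n))<..})"
    then obtain n where "inverse (real (Suc n)) < t" by auto
    moreover have "0 < inverse (real (Suc n))" by simp
    ultimately show "t \<in> {0<..}" unfolding greaterThan_iff by (rule less_trans[rotated])
  next
    fix t :: real assume "t \<in> {0<..}"
    then show "t \<in> (\<Union>n. {inverse (real (Suc n))<..})" using reals_Archimedean[of t] by auto
  qed
  ultimately show ?thesis by simp
qed

end

section \<open>Spectral measures of positive operators\<close>

locale positive_spectral = pvm E for E :: "real set \<Rightarrow> 'a::{complex_inner,banach} \<Rightarrow> 'a" +
  fixes D :: "'a set" and A :: "'a \<Rightarrow> 'a"
  assumes positive: "positive_self_adjoint D A" and spectral: "is_spectral_integral E (\<lambda>t. t) D A"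
begin

text \<open>Cutting to bounded windows puts the vectors into \<open>D\<close>, where positivity of
  the form applies. Over a negative window the integral of \<open>t\<close> cannot be positive, so
  it vanishes and the window carries no mass.\<close>

lemma E_negative: "E {..<0} h = 0"
proof -
  have "E {- real n..<0} h = 0" for n
  proof -
    let ?C = "{- real n..<0}" and ?M = "scalar_measure E h"
    define f where "f = E {- real n..<0} h"
    have fD: "f \<in> D"
      using spectral E_in_fcalc_dom_bounded[of ?C "\<lambda>t. t" "real n" h]
      by (auto simp: is_spectral_integral_def f_def)
    have Ef: "E ?C f = f" by (simp add: f_def Int)
    have "cinner f (A f) = of_real (\<integral>t. t * indicator ?C t \<partial>scalar_measure E f)"
      using cinner_E_spectral_integral[OF spectral _ _ fD, of ?C] by (simp add: Ef)
    then have nonneg: "0 \<le> (\<integral>t. t * indicator ?C t \<partial>scalar_measure E f)"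
      using positive fD by (auto simp: positive_self_adjoint_def)
    have int: "integrable (scalar_measure E f) (\<lambda>t. - (t * indicator ?C t))"
      using fcalc_dom_integrable[of "\<lambda>t. t" f] fD spectral
      by (intro integrable_minus integrable_real_mult_indicator) (auto simp: is_spectral_integral_def)
    have nn: "AE t in scalar_measure E f. 0 \<le> - (t * indicator ?C t)"
      by (auto simp: indicator_def)
    have "0 \<le> (\<integral>t. - (t * indicator ?C t) \<partial>scalar_measure E f)"
      using nn by (rule integral_nonneg_AE)
    with nonneg have "(\<integral>t. - (t * indicator ?C t) \<partial>scalar_measure E f) = 0" by simp
    then have "AE t in scalar_measure E f. - (t * indicator ?C t) = 0"
      using integral_nonneg_eq_0_iff_AE[OF int nn] by simp
    then have "AE t in scalar_measure E f. t \<notin> ?C"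
      by (rule AE_mp) (auto simp: indicator_def)
    then have "?C \<in> null_sets (scalar_measure E f)"
      by (subst (asm) AE_iff_null_sets[symmetric]) auto
    then have "emeasure (scalar_measure E f) ?C = 0" by auto
    then show ?thesis by (simp add: emeasure_scalar_measure Ef) (simp add: f_def)
  qed
  then have "E (\<Union>n. {- real n..<0}) h = 0"
    by (intro E_union_eq_zero) auto
  moreover have "(\<Union>n. {- real n..<0}) = {..<0}"
  proof (intro equalityI subsetI)
    fix t :: real assume "t \<in> {..<0}"
    moreover obtain n where "- t \<le> real n" using real_arch_simple by blast
    ultimately show "t \<in> (\<Union>n. {- real n..<0})" by (auto intro!: exI[of _ n])
  qed auto
  ultimately show ?thesis by simp
qed

text \<open>With \<open>A\<close> known as a form, \<open>A f = 0\<close> is obtained by testing.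
  Pairing \<open>A g\<close> with \<open>E {0} g\<close> integrates \<open>t\<close> over
  \<open>{0}\<close> and gives 0; polarization yields \<open><f, A g> = 0\<close> for
  \<open>g\<close> in \<open>D\<close>, symmetry moves this to \<open><g, A f> = 0\<close>, and
  \<open>D\<close> is dense.\<close>

lemma E_zero_in_null_space: "E {0} h \<in> null_space D A"
proof -
  define f where "f = E {0} h"
  have fD: "f \<in> D"
    using spectral E_in_fcalc_dom_bounded[of "{0}" "\<lambda>t. t" 0 h]
    by (auto simp: is_spectral_integral_def f_def)
  have sub: "complex_vector.subspace D" and lin: "linear_operator D A" and dense: "closure D = UNIV"
    using positive by (auto simp: positive_self_adjoint_def self_adjoint_def linear_operator_def)
  have sym: "cinner (A g) g' = cinner g (A g')" if "g \<in> D" "g' \<in> D" for g g'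
    using positive that unfolding positive_self_adjoint_def self_adjoint_def by blast
  have form: "cinner (E {0} g) (A g) = 0" if "g \<in> D" for g
  proof -
    have "(\<integral>t. t * indicator {0} t \<partial>scalar_measure E g) = (\<integral>t. 0 \<partial>scalar_measure E g)"
      by (intro Bochner_Integration.integral_cong refl) (auto simp: indicator_def)
    then show ?thesis
      using cinner_E_spectral_integral[OF spectral _ _ that, of "{0}"] by simp
  qed
  have perp: "cinner g (A f) = 0" if gD: "g \<in> D" for g
  proof -
    have "c * cinner (E {0} f) (A g) + cnj c * cinner (E {0} g) (A f) = 0" for c
    proof -
      have cg: "c *\<^sub>C g \<in> D" by (rule complex_vector.subspace_scale[OF sub gD])
      have "cinner (E {0} (f + c *\<^sub>C g)) (A (f + c *\<^sub>C g)) = 0"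
        by (intro form complex_vector.subspace_add[OF sub fD cg])
      then show ?thesis
        using form[OF fD] form[OF gD] fD gD cg lin
        by (simp add: linear_operator_def add scaleC cinner_add_left cinner_add_right
            cinner_scaleC_left cinner_scaleC_right)
    qed
    from this[of 1] this[of \<i>] have "cinner (E {0} f) (A g) = 0"
      by (simp add: complex_eq_iff)
    then have "cinner (A g) f = 0"
      by (simp add: f_def Int cinner_eq_zero_commute[of "A g"])
    then show ?thesis using sym[OF gD fD] by simp
  qed
  have "cinner (A f) (A f) = 0"
    using perp dense cinner_eq_zero_closure[of D "A f" "A f"] cinner_eq_zero_commute by blast
  then show ?thesis using fD by (simp add: null_space_def cinner_self f_def)
qed

end

section \<open>Completeness of the space of square-integrable functions\<close>

instance separable_hilbert \<subseteq> banach ..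

lemma L2_cases:
  obtains f where "square_integrable f" "F = abs_L2 f"
  using Quotient_rep_reflp[OF Quotient_L2, of F] Quotient_abs_rep[OF Quotient_L2, of F] by metis

lemma abs_L2_eqI:
  "square_integrable f \<Longrightarrow> square_integrable g \<Longrightarrow> AE x in \<mu>. f x = g x \<Longrightarrow> abs_L2 f = abs_L2 g"
  by (rule Quotient_rel_abs[OF Quotient_L2]) simp

lemma norm_abs_L2:
  fixes f :: "'x::sigma_finite_space \<Rightarrow> 'h::separable_hilbert"
  assumes "square_integrable f"
  shows "ennreal ((norm (abs_L2 f))\<^sup>2) = (\<integral>\<^sup>+ x. ennreal ((norm (f x))\<^sup>2) \<partial>\<mu>)"
proof -
  have int: "integrable \<mu> (\<lambda>x. (norm (f x))\<^sup>2)"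
    using assms by (simp add: square_integrable_def)
  have "complex_of_real ((norm (abs_L2 f))\<^sup>2) = (\<integral>x. cinner (f x) (f x) \<partial>\<mu>)"
    using assms by (simp add: cinner_self[symmetric] cinner_L2.abs_eq del: of_real_power)
  also have "\<dots> = of_real (\<integral>x. (norm (f x))\<^sup>2 \<partial>\<mu>)"
    by (simp add: cinner_self del: of_real_power)
  finally have "(norm (abs_L2 f))\<^sup>2 = (\<integral>x. (norm (f x))\<^sup>2 \<partial>\<mu>)"
    by (simp only: of_real_eq_iff)
  then show ?thesis
    using nn_integral_eq_integral[OF int] by simp
qed

lemma square_integrable_iff_nn_integral:
  fixes f :: "'x::sigma_finite_space \<Rightarrow> 'h::separable_hilbert"
  shows "square_integrable f \<longleftrightarrow>
    f \<in> borel_measurable \<mu> \<and> (\<integral>\<^sup>+ x. ennreal ((norm (f x))\<^sup>2) \<partial>\<mu>) < \<infinity>"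
  by (auto simp: square_integrable_def integrable_iff_bounded)

text \<open>Riesz--Fischer: if \<open>\<parallel>f\<^sub>k\<^sub>+\<^sub>1 - f\<^sub>k\<parallel> \<le> 2\<^sup>-\<^sup>k\<close>, then \<open>\<Sum> 2\<^sup>k |f\<^sub>k\<^sub>+\<^sub>1 - f\<^sub>k|\<^sup>2\<close> is integrable, hence
  \<open>|f\<^sub>k\<^sub>+\<^sub>1 - f\<^sub>k| \<le> C 2\<^sup>-\<^sup>k\<^sup>/\<^sup>2\<close> almost everywhere.\<close>

lemma rapidly_Cauchy_AE_convergent:
  fixes f :: "nat \<Rightarrow> 'x::sigma_finite_space \<Rightarrow> 'h::separable_hilbert"
  assumes meas [measurable]: "\<And>k. f k \<in> borel_measurable \<mu>"
    and bound: "\<And>k. (\<integral>\<^sup>+ x. ennreal ((norm (f (Suc k) x - f k x))\<^sup>2) \<partial>\<mu>) \<le> ennreal ((1/4) ^ k)"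
  shows "AE x in \<mu>. convergent (\<lambda>k. f k x)"
proof -
  define d where "d k x = norm (f (Suc k) x - f k x)" for k x
  have [measurable]: "d k \<in> borel_measurable \<mu>" for k unfolding d_def by measurable
  let ?s = "\<lambda>x. \<Sum>k. ennreal (2 ^ k * (d k x)\<^sup>2)"
  have "(\<integral>\<^sup>+ x. ?s x \<partial>\<mu>) = (\<Sum>k. \<integral>\<^sup>+ x. ennreal (2 ^ k * (d k x)\<^sup>2) \<partial>\<mu>)"
    by (intro nn_integral_suminf) measurable
  also have "\<dots> \<le> (\<Sum>k. ennreal ((1/2) ^ k))"
  proof (intro suminf_le summableI)
    fix k
    have "(\<integral>\<^sup>+ x. ennreal (2 ^ k * (d k x)\<^sup>2) \<partial>\<mu>) = ennreal (2 ^ k) * (\<integral>\<^sup>+ x. ennreal ((d k x)\<^sup>2) \<partial>\<mu>)"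
      by (simp add: ennreal_mult nn_integral_cmult)
    also have "\<dots> \<le> ennreal (2 ^ k) * ennreal ((1/4) ^ k)"
      unfolding d_def by (intro mult_left_mono bound) simp
    also have "\<dots> = ennreal ((1/2) ^ k)"
      by (simp add: ennreal_mult[symmetric] power_mult_distrib[symmetric])
    finally show "(\<integral>\<^sup>+ x. ennreal (2 ^ k * (d k x)\<^sup>2) \<partial>\<mu>) \<le> ennreal ((1/2) ^ k)" .
  qed
  also have "\<dots> = ennreal (\<Sum>k. (1/2) ^ k)"
    by (intro suminf_ennreal2 summable_geometric) auto
  also have "\<dots> < \<infinity>" by (rule ennreal_less_top[folded infinity_ennreal_def])
  finally have "(\<integral>\<^sup>+ x. ?s x \<partial>\<mu>) \<noteq> \<infinity>" by (rule less_imp_neq)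
  then have "AE x in \<mu>. ?s x \<noteq> \<infinity>"
    by (intro nn_integral_PInf_AE) measurable
  then show ?thesis
  proof (rule AE_mp, intro AE_I2 impI)
    fix x assume "?s x \<noteq> \<infinity>"
    then have "?s x < top" by (simp add: less_top)
    define C where "C = enn2real (?s x)"
    have C: "C \<ge> 0" "?s x = ennreal C"
      using \<open>?s x < top\<close> unfolding C_def
      by (simp_all only: enn2real_nonneg ennreal_enn2real)
    have le: "d k x \<le> sqrt C * sqrt (1/2) ^ k" for k
    proof -
      have "ennreal (2 ^ k * (d k x)\<^sup>2) \<le> ennreal C"
        using sum_le_suminf[OF summableI, of "{k}" "\<lambda>k. ennreal (2 ^ k * (d k x)\<^sup>2)"] C by simp
      then have "2 ^ k * (d k x)\<^sup>2 \<le> C" using C by (simp add: ennreal_le_iff)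
      then have "(d k x)\<^sup>2 \<le> C * (1/2) ^ k" by (simp add: power_one_over field_simps)
      then have "sqrt ((d k x)\<^sup>2) \<le> sqrt (C * (1/2) ^ k)" by (rule real_sqrt_le_mono)
      then show ?thesis by (simp add: d_def real_sqrt_mult real_sqrt_power del: real_sqrt_divide)
    qed
    have "summable (\<lambda>k. sqrt C * sqrt (1/2) ^ k)"
      by (intro summable_mult summable_geometric) (simp add: real_sqrt_less_iff)
    then have "summable (\<lambda>k. f (Suc k) x - f k x)"
      by (rule summable_comparison_test'[where N = 0]) (use le in \<open>simp add: d_def\<close>)
    then have "convergent (\<lambda>n. f 0 x + (\<Sum>k<n. f (Suc k) x - f k x))"
      by (intro convergent_add convergent_const) (simp add: summable_iff_convergent)
    then show "convergent (\<lambda>k. f k x)"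
      by (simp add: sum_lessThan_telescope[of "\<lambda>k. f k x"])
  qed
qed

text \<open>Fatou's lemma bounds the distance of the almost everywhere limit from \<open>f k\<close>
  by \<open>(1/2)^k\<close>. The same bound shows the limit to be square integrable, hence to
  represent an element of the space.\<close>

lemma L2_rapidly_Cauchy_convergent:
  fixes X :: "nat \<Rightarrow> ('x::sigma_finite_space, 'h::separable_hilbert) L2"
  assumes X: "\<And>j k. k \<le> j \<Longrightarrow> norm (X j - X k) \<le> (1/2) ^ k"
  shows "convergent X"
proof -
  have "\<forall>k. \<exists>g. square_integrable g \<and> X k = abs_L2 g"
    using L2_cases by metis
  then obtain f where f: "\<And>k. square_integrable (f k)" "\<And>k. X k = abs_L2 (f k)"
    by metis
  have [measurable]: "f k \<in> borel_measurable \<mu>" for k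
    using f(1) by (simp add: square_integrable_def)
  have le: "(\<integral>\<^sup>+ x. ennreal ((norm (f j x - f k x))\<^sup>2) \<partial>\<mu>) \<le> ennreal ((1/4) ^ k)" if "k \<le> j" for j k
  proof -
    have "X j - X k = abs_L2 (\<lambda>x. f j x - f k x)"
      using f by (simp add: minus_L2.abs_eq)
    then have "(\<integral>\<^sup>+ x. ennreal ((norm (f j x - f k x))\<^sup>2) \<partial>\<mu>) = ennreal ((norm (X j - X k))\<^sup>2)"
      using f(1) by (simp add: norm_abs_L2 square_integrable_diff)
    also have "\<dots> \<le> ennreal (((1/2) ^ k)\<^sup>2)"
      using X[OF that] by (intro ennreal_leI power_mono) auto
    also have "((1/2 :: real) ^ k)\<^sup>2 = (1/4) ^ k"
      by (simp add: power_even_eq[symmetric] power_mult power2_eq_square power_mult_distrib[symmetric])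
    finally show ?thesis .
  qed
  have conv: "AE x in \<mu>. convergent (\<lambda>k. f k x)"
    by (rule rapidly_Cauchy_AE_convergent) (use le in auto)
  \<comment> \<open>Where the sequence diverges \<open>lim\<close> is an unspecified value; this
    happens only on a null set.\<close>
  define h where "h x = lim (\<lambda>k. f k x)" for x
  have [measurable]: "h \<in> borel_measurable \<mu>" unfolding h_def by measurable
  have fatou: "(\<integral>\<^sup>+ x. ennreal ((norm (h x - f k x))\<^sup>2) \<partial>\<mu>) \<le> ennreal ((1/4) ^ k)" for k
  proof -
    have "(\<integral>\<^sup>+ x. ennreal ((norm (h x - f k x))\<^sup>2) \<partial>\<mu>) =
       (\<integral>\<^sup>+ x. liminf (\<lambda>j. ennreal ((norm (f j x - f k x))\<^sup>2)) \<partial>\<mu>)"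
    proof (rule nn_integral_cong_AE, rule AE_mp[OF conv], intro AE_I2 impI)
      fix x assume "convergent (\<lambda>k. f k x)"
      then have "(\<lambda>j. f j x) \<longlonglongrightarrow> h x" by (simp add: h_def convergent_LIMSEQ_iff)
      then have "(\<lambda>j. ennreal ((norm (f j x - f k x))\<^sup>2)) \<longlonglongrightarrow> ennreal ((norm (h x - f k x))\<^sup>2)"
        by (intro tendsto_intros)
      then show "ennreal ((norm (h x - f k x))\<^sup>2) = liminf (\<lambda>j. ennreal ((norm (f j x - f k x))\<^sup>2))"
        by (intro lim_imp_Liminf[symmetric]) auto
    qed
    also have "\<dots> \<le> liminf (\<lambda>j. \<integral>\<^sup>+ x. ennreal ((norm (f j x - f k x))\<^sup>2) \<partial>\<mu>)"
      by (intro nn_integral_liminf) measurable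
    also have "\<dots> \<le> ennreal ((1/4) ^ k)"
    proof -
      have "liminf (\<lambda>j. \<integral>\<^sup>+ x. ennreal ((norm (f j x - f k x))\<^sup>2) \<partial>\<mu>) \<le> liminf (\<lambda>j. ennreal ((1/4) ^ k))"
        using le by (intro Liminf_mono eventually_sequentiallyI[of k])
      then show ?thesis by (simp add: Liminf_const)
    qed
    finally show ?thesis .
  qed
  have sq: "square_integrable (\<lambda>x. h x - f k x)" for k
    unfolding square_integrable_iff_nn_integral using le_less_trans[OF fatou, of k] by simp
  have sqh: "square_integrable h"
    using square_integrable_add[OF sq[of 0] f(1)[of 0]] by simp
  have "norm (X k - abs_L2 h) \<le> (1/2) ^ k" for k
  proof -
    have "abs_L2 h - X k = abs_L2 (\<lambda>x. h x - f k x)"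
      using f sqh by (simp add: minus_L2.abs_eq)
    then have "ennreal ((norm (abs_L2 h - X k))\<^sup>2) \<le> ennreal ((1/4) ^ k)"
      using fatou[of k] sq[of k] by (simp add: norm_abs_L2)
    then have "(norm (abs_L2 h - X k))\<^sup>2 \<le> (1/4) ^ k" by (simp add: ennreal_le_iff)
    also have "\<dots> = ((1/2) ^ k)\<^sup>2"
      by (simp add: power_even_eq[symmetric] power_mult power2_eq_square power_mult_distrib[symmetric])
    finally have "norm (abs_L2 h - X k) \<le> (1/2) ^ k"
      by (rule power2_le_imp_le) simp
    then show ?thesis by (simp add: norm_minus_commute)
  qed
  then have "(\<lambda>k. X k - abs_L2 h) \<longlonglongrightarrow> 0"
    by (intro Lim_null_comparison[OF always_eventually LIMSEQ_power_zero[of "1/2"]]) auto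
  then show ?thesis
    by (auto simp: convergent_def LIM_zero_iff)
qed

instance L2 :: (sigma_finite_space, separable_hilbert) banach
proof
  fix X :: "nat \<Rightarrow> ('a, 'b) L2" assume X: "Cauchy X"
  have "\<exists>M. \<forall>m\<ge>M. \<forall>n\<ge>M. norm (X m - X n) < (1/2) ^ k" for k
    by (rule CauchyD[OF X]) simp
  then obtain M where M: "\<And>k m n. m \<ge> M k \<Longrightarrow> n \<ge> M k \<Longrightarrow> norm (X m - X n) < (1/2) ^ k"
    by metis
  \<comment> \<open>The summand \<open>k\<close> makes \<open>r\<close> strictly increasing, and the
    sum makes \<open>r k\<close> at least \<open>M k\<close>.\<close>
  define r where "r k = k + (\<Sum>i\<le>k. M i)" for k
  have r: "strict_mono r" by (rule strict_monoI_Suc) (simp add: r_def)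
  have rM: "M k \<le> r k" for k unfolding r_def by (simp add: member_le_sum trans_le_add2)
  have "convergent (X \<circ> r)"
  proof (rule L2_rapidly_Cauchy_convergent)
    fix j k :: nat assume "k \<le> j"
    then have "r k \<le> r j" using r by (simp add: strict_mono_less_eq)
    then show "norm ((X \<circ> r) j - (X \<circ> r) k) \<le> (1/2) ^ k"
      using M[of k "r j" "r k"] rM[of k] by (simp add: less_imp_le)
  qed
  then show "convergent X"
    using Cauchy_converges_subseq[OF X r] by (auto simp: convergent_def)
qed

section \<open>Multiplication by indicator functions and the density\<close>

lemma chi_abs_L2:
  "square_integrable f \<Longrightarrow> \<Omega> \<in> sets \<mu> \<Longrightarrow> chi \<Omega> (abs_L2 f) = abs_L2 (\<lambda>x. if x \<in> \<Omega> then f x else 0)"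
  by (simp add: chi.abs_eq)

lemma square_integrable_restrict:
  assumes "square_integrable f" "\<Omega> \<in> sets \<mu>"
  shows "square_integrable (\<lambda>x. if x \<in> \<Omega> then f x else 0)"
proof (rule square_integrable_bound[where g = "\<lambda>x. (norm (f x))\<^sup>2"])
  show "(\<lambda>x. if x \<in> \<Omega> then f x else 0) \<in> borel_measurable \<mu>"
    using assms by (intro measurable_If_set) (auto simp: square_integrable_def)
qed (use assms in \<open>auto simp: square_integrable_def\<close>)

text \<open>The rest is automatic: linearity by testing against vectors, and boundedness because
  \<open>|P f|^2 = <f, P f> <= |f| |P f|\<close>.\<close>

lemma orthogonal_projectionI:
  assumes sym: "\<And>f g. cinner (P f) g = cinner f (P g)" and idem: "\<And>f. P (P f) = P f"
  shows "orthogonal_projection P"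
proof -
  have sym': "cinner f (P g) = cinner (P f) g" for f g by (simp add: sym)
  have "bounded_linear P"
  proof (rule bounded_linear_intro[where K = 1])
    show "P (f + g) = P f + P g" for f g
      by (rule cinner_extensionality) (simp add: sym' cinner_add_right)
    show "P (r *\<^sub>R f) = r *\<^sub>R P f" for r f
      unfolding scaleR_scaleC by (rule symmetric_scaleC) (rule sym)
    show "norm (P f) \<le> norm f * 1" for f
    proof -
      have "complex_of_real ((norm (P f))\<^sup>2) = cinner f (P f)"
        by (metis cinner_self sym idem)
      then have "(norm (P f))\<^sup>2 = cmod (cinner f (P f))"
        by (metis abs_of_nonneg norm_of_real zero_le_power2)
      also have "\<dots> \<le> norm f * norm (P f)" by (rule complex_Cauchy_Schwarz)
      finally show ?thesis by (cases "P f = 0") (simp_all add: power2_eq_square)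
    qed
  qed
  then show ?thesis using sym idem by (simp add: orthogonal_projection_iff)
qed

lemma orthogonal_projection_chi:
  fixes \<Omega> :: "'x::sigma_finite_space set"
  assumes \<Omega>: "\<Omega> \<in> sets \<mu>"
  shows "orthogonal_projection (chi \<Omega> :: ('x, 'h::separable_hilbert) L2 \<Rightarrow> _)"
proof (rule orthogonal_projectionI)
  fix F G :: "('x, 'h) L2"
  obtain f g where fg: "square_integrable f" "F = abs_L2 f" "square_integrable g" "G = abs_L2 g"
    using L2_cases by metis
  note sq = square_integrable_restrict[OF _ \<Omega>]
  have "(\<integral>x. cinner (if x \<in> \<Omega> then f x else 0) (g x) \<partial>\<mu>) = (\<integral>x. cinner (f x) (if x \<in> \<Omega> then g x else 0) \<partial>\<mu>)"
    by (intro Bochner_Integration.integral_cong) auto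
  then show "cinner (chi \<Omega> F) G = cinner F (chi \<Omega> G)"
    using fg sq[of f] sq[of g] by (simp add: chi_abs_L2 \<Omega> cinner_L2.abs_eq)
  show "chi \<Omega> (chi \<Omega> F) = chi \<Omega> F"
    using fg sq[of f] by (simp add: chi_abs_L2 \<Omega> cong: if_cong)
qed

text \<open>Seen as the mass of \<open>\<Omega>\<close> under the measure with density
  \<open>|f|^2\<close>, the squared norm inherits countable additivity and absolute
  continuity.\<close>

lemma norm_chi:
  assumes f: "square_integrable f" and \<Omega>: "\<Omega> \<in> sets \<mu>"
  shows "ennreal ((norm (chi \<Omega> (abs_L2 f)))\<^sup>2) = emeasure (density \<mu> (\<lambda>x. ennreal ((norm (f x))\<^sup>2))) \<Omega>"
proof -
  have [measurable]: "f \<in> borel_measurable \<mu>" using f by (simp add: square_integrable_def)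
  have "ennreal ((norm (chi \<Omega> (abs_L2 f)))\<^sup>2) = (\<integral>\<^sup>+ x. ennreal ((norm (if x \<in> \<Omega> then f x else 0))\<^sup>2) \<partial>\<mu>)"
    using f \<Omega> by (simp add: chi_abs_L2 norm_abs_L2 square_integrable_restrict)
  also have "\<dots> = (\<integral>\<^sup>+ x. ennreal ((norm (f x))\<^sup>2) * indicator \<Omega> x \<partial>\<mu>)"
    by (intro nn_integral_cong) (auto simp: indicator_def)
  also have "\<dots> = emeasure (density \<mu> (\<lambda>x. ennreal ((norm (f x))\<^sup>2))) \<Omega>"
    using \<Omega> by (intro emeasure_density[symmetric]) measurable
  finally show ?thesis .
qed

lemma norm_chi_countably_additive:
  assumes "range B \<subseteq> sets \<mu>" "disjoint_family B"
  shows "(\<Sum>n. ennreal ((norm (chi (B n) F))\<^sup>2)) = ennreal ((norm (chi (\<Union>n. B n) F))\<^sup>2)"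
proof -
  obtain f where f: "square_integrable f" "F = abs_L2 f" using L2_cases by metis
  let ?N = "density \<mu> (\<lambda>x. ennreal ((norm (f x))\<^sup>2))"
  have "(\<Sum>n. emeasure ?N (B n)) = emeasure ?N (\<Union>n. B n)"
    using assms by (intro suminf_emeasure) auto
  moreover have "B n \<in> sets \<mu>" "(\<Union>n. B n) \<in> sets \<mu>" for n
    using assms(1) by auto
  ultimately show ?thesis using f by (simp add: norm_chi)
qed

lemma chi_null_set:
  assumes "\<Omega> \<in> null_sets \<mu>"
  shows "chi \<Omega> F = 0"
proof -
  obtain f where f: "square_integrable f" "F = abs_L2 f" using L2_cases by metis
  then have "f \<in> borel_measurable \<mu>" by (simp add: square_integrable_def)
  then have "\<Omega> \<in> null_sets (density \<mu> (\<lambda>x. ennreal ((norm (f x))\<^sup>2)))"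
    using AE_not_in[OF assms] assms by (subst null_sets_density_iff) auto
  then have "ennreal ((norm (chi \<Omega> F))\<^sup>2) = 0"
    using f norm_chi[of f \<Omega>] assms by (auto simp: null_sets_def)
  then show ?thesis by simp
qed

lemma chi_vanishes_outside:
  assumes "vanishes_outside \<Omega> F" "\<Omega> \<in> sets \<mu>"
  shows "chi \<Omega> F = F"
proof -
  obtain f where f: "square_integrable f" "F = abs_L2 f" using L2_cases by metis
  then have "AE x in \<mu>. x \<notin> \<Omega> \<longrightarrow> f x = 0"
    using assms(1) by (simp add: vanishes_outside.abs_eq)
  then have "AE x in \<mu>. (if x \<in> \<Omega> then f x else 0) = f x"
    by (rule AE_mp) auto
  then show ?thesis
    unfolding f(2) chi_abs_L2[OF f(1) assms(2)]
    by (intro abs_L2_eqI square_integrable_restrict f assms)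
qed

section \<open>The local trace as a measure\<close>

text \<open>The trace is first a Hilbert-Schmidt sum of \<open>P (chi \<Omega> e)\<close>. Passing
  to the adjoint product puts \<open>chi\<close> outermost, so that each summand is a measure in
  \<open>\<Omega>\<close> for fixed \<open>e\<close>.\<close>

lemma nu_eq_infsum:
  fixes P :: "('x::sigma_finite_space, 'h::separable_hilbert) L2 \<Rightarrow> ('x, 'h) L2"
  assumes P: "orthogonal_projection P" and \<Omega>: "\<Omega> \<in> sets \<mu>"
  shows "nu P \<Omega> = (\<Sum>\<^sub>\<infinity>e\<in>some_basis. ennreal ((norm (chi \<Omega> (P e)))\<^sup>2))"
proof -
  note C = orthogonal_projection_chi[OF \<Omega>, where 'h = 'h]
  have "cinner e (chi \<Omega> (P (chi \<Omega> e))) = of_real ((norm (P (chi \<Omega> e)))\<^sup>2)" for e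
    using C unfolding orthogonal_projection_cinner_self[OF P, symmetric]
    by (simp add: orthogonal_projection_iff)
  then have "nu P \<Omega> = (\<Sum>\<^sub>\<infinity>e\<in>some_basis. ennreal ((norm (P (chi \<Omega> e)))\<^sup>2))"
    by (simp add: nu_def op_trace_def)
  also have "\<dots> = (\<Sum>\<^sub>\<infinity>e\<in>some_basis. ennreal ((norm (chi \<Omega> (P e)))\<^sup>2))"
  proof (rule hilbert_schmidt_adjoint[OF orthonormal_basis_some_basis])
    show "cinner (P (chi \<Omega> x)) y = cinner x (chi \<Omega> (P y))" for x y
      using P C by (simp add: orthogonal_projection_iff)
  qed
  finally show ?thesis .
qed

text \<open>Each basis vector contributes a countably additive set function; interchanging the sum
  over sets with that over the basis gives the same for the total.\<close>

lemma emeasure_nu_measure: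
  assumes P: "orthogonal_projection P" and \<Omega>: "\<Omega> \<in> sets \<mu>"
  shows "emeasure (nu_measure P) \<Omega> = nu P \<Omega>"
  unfolding nu_measure_def
proof (rule emeasure_measure_of_sigma[OF sets.sigma_algebra_axioms _ _ \<Omega>])
  show "positive (sets \<mu>) (nu P)"
    by (simp add: positive_def nu_eq_infsum[OF P] chi_null_set)
  show "countably_additive (sets \<mu>) (nu P)"
  proof (rule countably_additiveI)
    fix B :: "nat \<Rightarrow> 'a set" assume B: "range B \<subseteq> sets \<mu>" "disjoint_family B"
    have "(\<Sum>n. nu P (B n)) = infsum (\<lambda>n. \<Sum>\<^sub>\<infinity>e\<in>some_basis. ennreal ((norm (chi (B n) (P e)))\<^sup>2)) UNIV"
      unfolding infsum_ennreal_nat using B(1) by (intro suminf_cong nu_eq_infsum[OF P]) auto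
    also have "\<dots> = (\<Sum>\<^sub>\<infinity>e\<in>some_basis. infsum (\<lambda>n. ennreal ((norm (chi (B n) (P e)))\<^sup>2)) UNIV)"
      by (rule infsum_ennreal_swap)
    also have "\<dots> = (\<Sum>\<^sub>\<infinity>e\<in>some_basis. ennreal ((norm (chi (\<Union>n. B n) (P e)))\<^sup>2))"
      by (simp only: infsum_ennreal_nat norm_chi_countably_additive[OF B])
    also have "\<dots> = nu P (\<Union>n. B n)"
      using B(1) by (intro nu_eq_infsum[OF P, symmetric]) auto
    finally show "(\<Sum>n. nu P (B n)) = nu P (\<Union>n. B n)" .
  qed
qed

text \<open>On null sets \<open>chi\<close> is zero, so Radon-Nikodym recovers the local trace as
  the integral of its derivative, which the essential supremum bounds almost everywhere.\<close>

lemma nu_le_op_density: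
  fixes P :: "('x::sigma_finite_space, 'h::separable_hilbert) L2 \<Rightarrow> ('x, 'h) L2"
  assumes P: "orthogonal_projection P" and \<Omega>: "\<Omega> \<in> sets \<mu>"
  shows "nu P \<Omega> \<le> emeasure \<mu> \<Omega> * op_density P"
proof -
  interpret sigma_finite_measure "\<mu> :: 'x measure" by (rule sigma_finite_base_measure)
  let ?N = "nu_measure P"
  have sets: "sets ?N = sets \<mu>"
    by (simp add: nu_measure_def sets.sets_measure_of_eq)
  have "nu P B = 0" if "B \<in> null_sets \<mu>" for B
    using that by (subst nu_eq_infsum[OF P]) (auto simp: chi_null_set)
  then have "absolutely_continuous \<mu> ?N"
    by (auto simp: absolutely_continuous_def null_sets_def sets emeasure_nu_measure[OF P])
  then have dens: "density \<mu> (RN_deriv \<mu> ?N) = ?N"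
    using sets by (rule density_RN_deriv)
  have "nu P \<Omega> = emeasure (density \<mu> (RN_deriv \<mu> ?N)) \<Omega>"
    using \<Omega> by (simp only: dens emeasure_nu_measure[OF P])
  also have "\<dots> = (\<integral>\<^sup>+ x. RN_deriv \<mu> ?N x * indicator \<Omega> x \<partial>\<mu>)"
    using \<Omega> by (intro emeasure_density) measurable
  also have "\<dots> \<le> (\<integral>\<^sup>+ x. op_density P * indicator \<Omega> x \<partial>\<mu>)"
  proof (rule nn_integral_mono_AE)
    have "AE x in \<mu>. RN_deriv \<mu> ?N x \<le> op_density P"
      unfolding op_density_def by (rule esssup_AE)
    then show "AE x in \<mu>. RN_deriv \<mu> ?N x * indicator \<Omega> x \<le> op_density P * indicator \<Omega> x"
      by (rule AE_mp) (intro AE_I2 impI mult_right_mono zero_le)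
  qed
  also have "\<dots> = emeasure \<mu> \<Omega> * op_density P"
    using \<Omega> by (simp add: nn_integral_cmult_indicator mult.commute)
  finally show ?thesis .
qed

context positive_spectral
begin

lemma orthogonal_projection_spec_proj: "orthogonal_projection (spec_proj excl_zero E l)"
  by (simp add: spec_proj_def proj)

text \<open>The line splits into the negative axis, \<open>{0}\<close>, \<open>{0<..l}\<close> and
  \<open>{l<..}\<close>. The first carries nothing, and the second belongs to the projection or is
  killed by \<open>zero\<close>, so only the last remains in the complement.\<close>

lemma spec_proj_complement:
  assumes l: "0 \<le> l" and zero: "excl_zero \<Longrightarrow> E {0} h = 0"
  shows "h - spec_proj excl_zero E l h = E {l<..} h"
proof -
  have "{..<0} \<union> {0::real..} = UNIV" by auto
  then have "h = E ({..<0} \<union> {0..}) h" by simp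
  also have "\<dots> = E {0..} h"
    by (subst Un) (auto simp: E_negative)
  also have "{0..} = {0..l} \<union> {l<..}" using l by auto
  also have "E \<dots> h = E {0..l} h + E {l<..} h"
    by (rule Un) auto
  finally have h: "h = E {0..l} h + E {l<..} h" .
  have "E {0..l} h = E {0<..l} h" if excl_zero
  proof -
    have "{0..l} = {0} \<union> {0<..l}" using l by auto
    also have "E \<dots> h = E {0} h + E {0<..l} h" by (rule Un) auto
    finally show ?thesis using zero[OF that] by simp
  qed
  then have "spec_proj excl_zero E l h = E {0..l} h"
    by (simp add: spec_proj_def)
  then show ?thesis using h by (metis add_diff_cancel_left')
qed

lemma spec_proj_complement_norm_le:
  assumes "h \<in> fcalc_dom E sqrt" and "0 \<le> l" and "excl_zero \<Longrightarrow> E {0} h = 0"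
  shows "l * (norm (h - spec_proj excl_zero E l h))\<^sup>2 \<le> (norm (fcalc E sqrt h))\<^sup>2"
  using norm_E_le_fcalc_sqrt[OF assms(1,2)] spec_proj_complement[OF assms(2,3)] by simp

text \<open>Serves the threshold 0, where the quantitative bound says nothing: a vector annihilated
  by the square root has no spectral part on the positive axis.\<close>

lemma spec_proj_complement_eq_zero:
  assumes "h \<in> fcalc_dom E sqrt" and "fcalc E sqrt h = 0" and "excl_zero \<Longrightarrow> E {0} h = 0"
  shows "h - spec_proj excl_zero E 0 h = 0"
  using fcalc_sqrt_eq_zero[OF assms(1,2)] spec_proj_complement[OF order.refl assms(3)] by simp

text \<open>\<open>E {0} f\<close> itself lies in the kernel, so its squared norm
  \<open><E {0} f, f>\<close> vanishes.\<close>

lemma E_zero_eq_zero: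
  assumes "\<And>g. g \<in> null_space D A \<Longrightarrow> cinner g f = 0"
  shows "E {0} f = 0"
  using assms[OF E_zero_in_null_space, of f] cinner_E_E[of "{0}" UNIV f] by simp

end

section \<open>Operators supported in a set\<close>

lemma norm_sqrt_op_power2:
  fixes \<rho> :: "'a::{complex_inner,banach} \<Rightarrow> 'a"
  assumes "positive_bounded \<rho>"
  shows "(norm (sqrt_op \<rho> f))\<^sup>2 = Re (cinner f (\<rho> f))"
proof -
  have "cinner (sqrt_op \<rho> f) (sqrt_op \<rho> f) = cinner f (\<rho> f)"
    using sqrt_op[OF assms] by (simp add: positive_bounded_iff)
  then show ?thesis by (metis cinner_self Re_complex_of_real)
qed

lemma op_trace_eq_hilbert_schmidt:
  fixes \<rho> :: "'a::{complex_inner,banach} \<Rightarrow> 'a"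
  shows "positive_bounded \<rho> \<Longrightarrow>
    op_trace \<rho> = (\<Sum>\<^sub>\<infinity>e\<in>some_basis. ennreal ((norm (sqrt_op \<rho> e))\<^sup>2))"
  by (simp add: op_trace_def norm_sqrt_op_power2)

text \<open>Makes the trace of a nonzero operator a legitimate denominator. The root kills each
  basis vector, so by symmetry its range is orthogonal to the basis, and Parseval makes it
  zero.\<close>

lemma op_trace_eq_zero:
  fixes \<rho> :: "'a::{complex_inner,banach} \<Rightarrow> 'a"
  assumes \<rho>: "positive_bounded \<rho>" and tr: "op_trace \<rho> = 0"
  shows "\<rho> f = 0"
proof -
  let ?S = "sqrt_op \<rho>"
  have S0: "?S e = 0" if "e \<in> some_basis" for e
  proof -
    have "ennreal ((norm (?S e))\<^sup>2) \<le> op_trace \<rho>"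
      unfolding op_trace_eq_hilbert_schmidt[OF \<rho>]
      using infsum_ennreal_upper[of "{e}" some_basis] that by simp
    then show ?thesis using tr by simp
  qed
  have "cinner e (?S f) = 0" if "e \<in> some_basis" for e
    using S0[OF that] sqrt_op(1)[OF \<rho>] by (metis positive_bounded_iff cinner_zero_left)
  then have "ennreal ((norm (?S f))\<^sup>2) = 0"
    unfolding parseval[OF orthonormal_basis_some_basis, symmetric]
    by (intro infsum_0) simp
  then have "?S f = 0" by simp
  then show "\<rho> f = 0"
    using sqrt_op[OF \<rho>] positive_bounded_iff[of ?S] linear_simps(3)[of ?S] by metis
qed

text \<open>The squared norm of the root at \<open>g\<close> is \<open><g, \<rho> g>\<close>, so the
  root vanishes wherever \<open>\<rho>\<close> does, in particular at
  \<open>f - C f\<close>.\<close>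

lemma sqrt_op_supported:
  fixes \<rho> :: "'a::{complex_inner,banach} \<Rightarrow> 'a"
  assumes \<rho>: "positive_bounded \<rho>" and C: "orthogonal_projection C" and supp: "\<rho> = C \<circ> \<rho> \<circ> C"
  shows "sqrt_op \<rho> (C f) = sqrt_op \<rho> f"
proof -
  interpret C: bounded_linear C using C by (simp add: orthogonal_projection_iff)
  have bl: "bounded_linear \<rho>" "bounded_linear (sqrt_op \<rho>)"
    using \<rho> sqrt_op(1)[OF \<rho>] by (auto simp: positive_bounded_iff)
  have "C (f - C f) = 0" using C by (simp add: orthogonal_projection_iff C.diff)
  then have "\<rho> (f - C f) = 0"
    by (subst supp) (simp add: linear_simps(3)[OF bl(1)] C.zero)
  then have "sqrt_op \<rho> (f - C f) = 0"
    using norm_sqrt_op_power2[OF \<rho>, of "f - C f"] by simp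
  then show ?thesis by (simp add: linear_simps[OF bl(2)])
qed

text \<open>The adjoint exchange moves the projection inside, which allows \<open>chi\<close> to be
  inserted between root and projection; then \<open>|S g|^2 = <g, \<rho> g>\<close> is at most
  \<open>onorm \<rho>\<close> times \<open>|g|^2\<close>.\<close>

lemma hilbert_schmidt_projection_le:
  fixes \<rho> :: "('x::sigma_finite_space, 'h::separable_hilbert) L2 \<Rightarrow> ('x, 'h) L2"
  assumes \<rho>: "positive_bounded \<rho>" and \<Omega>: "\<Omega> \<in> sets \<mu>" and supp: "\<rho> = chi \<Omega> \<circ> \<rho> \<circ> chi \<Omega>"
    and P: "orthogonal_projection P"
  shows "(\<Sum>\<^sub>\<infinity>e\<in>some_basis. ennreal ((norm (P (sqrt_op \<rho> e)))\<^sup>2)) \<le> ennreal (onorm \<rho>) * nu P \<Omega>"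
proof -
  let ?S = "sqrt_op \<rho>"
  have bl: "bounded_linear \<rho>" using \<rho> by (simp add: positive_bounded_iff)
  have K: "0 \<le> onorm \<rho>" by (rule onorm_pos_le[OF bl])
  have "(\<Sum>\<^sub>\<infinity>e\<in>some_basis. ennreal ((norm (P (?S e)))\<^sup>2)) =
      (\<Sum>\<^sub>\<infinity>e\<in>some_basis. ennreal ((norm (?S (P e)))\<^sup>2))"
  proof (rule hilbert_schmidt_adjoint[OF orthonormal_basis_some_basis])
    show "cinner (P (?S x)) y = cinner x (?S (P y))" for x y
      using P sqrt_op(1)[OF \<rho>] by (simp add: orthogonal_projection_iff positive_bounded_iff)
  qed
  also have "\<dots> \<le> (\<Sum>\<^sub>\<infinity>e\<in>some_basis. ennreal (onorm \<rho>) * ennreal ((norm (chi \<Omega> (P e)))\<^sup>2))"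
  proof (rule infsum_ennreal_mono)
    fix e
    let ?g = "chi \<Omega> (P e)"
    have "(norm (?S (P e)))\<^sup>2 = Re (cinner ?g (\<rho> ?g))"
      using sqrt_op_supported[OF \<rho> orthogonal_projection_chi[OF \<Omega>] supp, of "P e"]
        norm_sqrt_op_power2[OF \<rho>, of ?g] by simp
    also have "\<dots> \<le> norm ?g * norm (\<rho> ?g)"
      using complex_Cauchy_Schwarz complex_Re_le_cmod order_trans by blast
    also have "\<dots> \<le> norm ?g * (onorm \<rho> * norm ?g)"
      by (intro mult_left_mono onorm[OF bl]) simp
    finally have "(norm (?S (P e)))\<^sup>2 \<le> onorm \<rho> * (norm ?g)\<^sup>2"
      by (simp add: power2_eq_square mult_ac)
    then show "ennreal ((norm (?S (P e)))\<^sup>2) \<le> ennreal (onorm \<rho>) * ennreal ((norm ?g)\<^sup>2)"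
      using K by (simp add: ennreal_mult[symmetric] ennreal_leI)
  qed
  also have "\<dots> = ennreal (onorm \<rho>) * nu P \<Omega>"
    by (simp add: infsum_ennreal_cmult nu_eq_infsum[OF P \<Omega>])
  finally show ?thesis .
qed

text \<open>Parseval expands each term, and symmetry with \<open>chi \<Omega> v = v\<close> turns
  \<open>|<e, P v>|\<close> into \<open>|<v, chi \<Omega> (P e)>|\<close>. Summing over
  \<open>v\<close> first, Bessel's inequality for \<open>W\<close> bounds the contribution of each
  \<open>e\<close>.\<close>

lemma sum_norm_projection_le_nu:
  fixes W :: "('x::sigma_finite_space, 'h::separable_hilbert) L2 set"
  assumes W: "finite W" "orthonormal W" and \<Omega>: "\<Omega> \<in> sets \<mu>"
    and supp: "\<And>v. v \<in> W \<Longrightarrow> chi \<Omega> v = v" and P: "orthogonal_projection P"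
  shows "(\<Sum>v\<in>W. ennreal ((norm (P v))\<^sup>2)) \<le> nu P \<Omega>"
proof -
  have adj: "cmod (cinner e (P v)) = cmod (cinner v (chi \<Omega> (P e)))" if "v \<in> W" for e v
  proof -
    have "cinner (chi \<Omega> (P e)) v = cinner e (P (chi \<Omega> v))"
      using P orthogonal_projection_chi[OF \<Omega>, where 'h = 'h]
      by (simp add: orthogonal_projection_iff)
    then show ?thesis using supp[OF that] cmod_cinner_commute by metis
  qed
  have "(\<Sum>v\<in>W. ennreal ((norm (P v))\<^sup>2)) =
      (\<Sum>v\<in>W. \<Sum>\<^sub>\<infinity>e\<in>some_basis. ennreal ((cmod (cinner e (P v)))\<^sup>2))"
    by (simp only: parseval[OF orthonormal_basis_some_basis])
  also have "\<dots> = (\<Sum>\<^sub>\<infinity>e\<in>some_basis. \<Sum>v\<in>W. ennreal ((cmod (cinner v (chi \<Omega> (P e))))\<^sup>2))"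
    by (simp add: infsum_ennreal_sum adj del: sum_ennreal)
  also have "\<dots> \<le> (\<Sum>\<^sub>\<infinity>e\<in>some_basis. ennreal ((norm (chi \<Omega> (P e)))\<^sup>2))"
    using bessel_infsum[OF W(2)] W(1) by (intro infsum_ennreal_mono) simp
  also have "\<dots> = nu P \<Omega>" by (rule nu_eq_infsum[OF P \<Omega>, symmetric])
  finally show ?thesis .
qed

context positive_spectral
begin

lemma energy_eq_infsum:
  assumes "energy E \<rho> < \<infinity>"
  shows "sqrt_op \<rho> f \<in> fcalc_dom E sqrt"
    and "energy E \<rho> = (\<Sum>\<^sub>\<infinity>e\<in>some_basis. ennreal ((norm (fcalc E sqrt (sqrt_op \<rho> e)))\<^sup>2))"
proof -
  have "range (sqrt_op \<rho>) \<subseteq> fcalc_dom E sqrt"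
    using assms by (auto simp: energy_def split: if_splits)
  then show "sqrt_op \<rho> f \<in> fcalc_dom E sqrt"
    and "energy E \<rho> = (\<Sum>\<^sub>\<infinity>e\<in>some_basis. ennreal ((norm (fcalc E sqrt (sqrt_op \<rho> e)))\<^sup>2))"
    by (auto simp: energy_def)
qed

text \<open>The root vanishes where \<open>\<rho>\<close> does, hence on the kernel of
  \<open>A\<close>, so by symmetry its range is orthogonal to that kernel.\<close>

lemma E_zero_sqrt_op:
  assumes \<rho>: "positive_bounded \<rho>" and null: "\<And>f. f \<in> null_space D A \<Longrightarrow> \<rho> f = 0"
  shows "E {0} (sqrt_op \<rho> f) = 0"
proof (rule E_zero_eq_zero)
  fix g assume "g \<in> null_space D A"
  then have "sqrt_op \<rho> g = 0"
    using norm_sqrt_op_power2[OF \<rho>, of g] null by simp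
  then show "cinner g (sqrt_op \<rho> f) = 0"
    using sqrt_op(1)[OF \<rho>] by (metis positive_bounded_iff cinner_zero_left)
qed

lemma tail_energy_le:
  assumes energy: "energy E \<rho> < \<infinity>" and l: "0 \<le> l" and zero: "\<And>f. excl_zero \<Longrightarrow> E {0} (sqrt_op \<rho> f) = 0"
  shows "ennreal l * (\<Sum>\<^sub>\<infinity>e\<in>some_basis.
      ennreal ((norm (sqrt_op \<rho> e - spec_proj excl_zero E l (sqrt_op \<rho> e)))\<^sup>2)) \<le> energy E \<rho>"
  unfolding energy_eq_infsum(2)[OF energy] infsum_ennreal_cmult[symmetric]
  using spec_proj_complement_norm_le[OF energy_eq_infsum(1)[OF energy] l zero] l
  by (intro infsum_ennreal_mono) (simp add: ennreal_mult[symmetric] ennreal_leI)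

lemma tail_eq_zero:
  assumes energy: "energy E \<rho> = 0" and zero: "\<And>f. excl_zero \<Longrightarrow> E {0} (sqrt_op \<rho> f) = 0"
    and e: "e \<in> some_basis"
  shows "sqrt_op \<rho> e - spec_proj excl_zero E 0 (sqrt_op \<rho> e) = 0"
proof (rule spec_proj_complement_eq_zero[OF _ _ zero])
  have fin: "energy E \<rho> < \<infinity>" using energy by simp
  show "sqrt_op \<rho> e \<in> fcalc_dom E sqrt" by (rule energy_eq_infsum(1)[OF fin])
  have "ennreal ((norm (fcalc E sqrt (sqrt_op \<rho> e)))\<^sup>2) \<le> energy E \<rho>"
    unfolding energy_eq_infsum(2)[OF fin]
    using infsum_ennreal_upper[of "{e}" some_basis "\<lambda>e. ennreal ((norm (fcalc E sqrt (sqrt_op \<rho> e)))\<^sup>2)"] e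
    by simp
  then show "fcalc E sqrt (sqrt_op \<rho> e) = 0" using energy by simp
qed

lemma op_trace_split:
  assumes \<rho>: "positive_bounded \<rho>"
  shows "op_trace \<rho> = (\<Sum>\<^sub>\<infinity>e\<in>some_basis. ennreal ((norm (spec_proj excl_zero E l (sqrt_op \<rho> e)))\<^sup>2)) +
    (\<Sum>\<^sub>\<infinity>e\<in>some_basis. ennreal ((norm (sqrt_op \<rho> e - spec_proj excl_zero E l (sqrt_op \<rho> e)))\<^sup>2))"
  unfolding op_trace_eq_hilbert_schmidt[OF \<rho>] infsum_ennreal_add[symmetric]
    orthogonal_projection_pythagoras[OF orthogonal_projection_spec_proj[of excl_zero l], of "sqrt_op \<rho> _"]
  by simp

end

section \<open>The trace and dimension estimates\<close>

lemma op_trace_le_F_local: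
  fixes E :: "real set \<Rightarrow> ('x::sigma_finite_space, 'h::separable_hilbert) L2 \<Rightarrow> ('x, 'h) L2"
  assumes spec: "positive_spectral E D A"
    and fin: "\<forall>l. F_density excl_zero E l < \<infinity>"
    and \<rho>: "positive_bounded \<rho>" and nz: "\<rho> \<noteq> (\<lambda>_. 0)"
    and null: "excl_zero \<longrightarrow> (\<forall>f\<in>null_space D A. \<rho> f = 0)"
    and \<Omega>: "\<Omega> \<in> sets \<mu>" "emeasure \<mu> \<Omega> < \<infinity>"
    and supp: "\<rho> = chi \<Omega> \<circ> \<rho> \<circ> chi \<Omega>" and energy: "energy E \<rho> < \<infinity>"
  shows "op_trace \<rho> / ennreal (4 * onorm \<rho>) \<le> F_local excl_zero E \<Omega> (4 * expectation_value E \<rho>)"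
proof -
  interpret positive_spectral E D A by fact
  define head tail where
    "head l = (\<Sum>\<^sub>\<infinity>e\<in>some_basis. ennreal ((norm (spec_proj excl_zero E l (sqrt_op \<rho> e)))\<^sup>2))" and
    "tail l = (\<Sum>\<^sub>\<infinity>e\<in>some_basis. ennreal ((norm (sqrt_op \<rho> e - spec_proj excl_zero E l (sqrt_op \<rho> e)))\<^sup>2))"
    for l
  have split: "op_trace \<rho> = head l + tail l" for l
    unfolding head_def tail_def by (rule op_trace_split[OF \<rho>])
  have zero: "E {0} (sqrt_op \<rho> f) = 0" if excl_zero for f
    using null that by (intro E_zero_sqrt_op[OF \<rho>]) auto
  have tail: "ennreal l * tail l \<le> energy E \<rho>" if "0 \<le> l" for l
    unfolding tail_def by (rule tail_energy_le[OF energy that zero])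
  have nu: "nu (spec_proj excl_zero E l) \<Omega> < \<infinity>" for l
    using nu_le_op_density[OF orthogonal_projection_spec_proj[of excl_zero l] \<Omega>(1)] \<Omega>(2) fin
    by (auto simp: F_density_def ennreal_mult_less_top intro: le_less_trans)
  have head: "head l \<le> ennreal (onorm \<rho>) * nu (spec_proj excl_zero E l) \<Omega>" for l
    unfolding head_def
    by (rule hilbert_schmidt_projection_le[OF \<rho> \<Omega>(1) supp orthogonal_projection_spec_proj])
  have head_fin: "head l < \<infinity>" for l
    using head[of l] nu[of l] by (auto simp: ennreal_mult_less_top intro: le_less_trans)
  have "tail 1 \<le> energy E \<rho>" using tail[of 1] by simp
  then have tr_fin: "op_trace \<rho> < \<infinity>"
    unfolding split[of 1] using head_fin[of 1] energy by (auto intro: le_less_trans)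
  define t where "t = enn2real (op_trace \<rho>)"
  define En where "En = enn2real (energy E \<rho>)"
  have t: "op_trace \<rho> = ennreal t" and En: "energy E \<rho> = ennreal En" and En0: "0 \<le> En"
    using tr_fin energy by (simp_all add: t_def En_def)
  have t0: "0 < t"
  proof (rule ccontr)
    assume "\<not> 0 < t"
    then have "op_trace \<rho> = 0" by (simp add: t ennreal_neg)
    then show False using op_trace_eq_zero[OF \<rho>] nz by auto
  qed
  define l where "l = 4 * expectation_value E \<rho>"
  \<comment> \<open>\<open>enn2real\<close> of the quotient is the real quotient because the trace
    is positive and finite; an infinite trace would have given the value 0.\<close>
  have l: "l = 4 * En / t"
    using t0 En0 by (simp add: l_def expectation_value_def t En divide_ennreal)
  have tail_le: "tail l \<le> ennreal (t / 4)"
  \<comment> \<open>For zero energy the threshold is 0 and the product bound is silent about the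
    tail, which vanishes because the square root of \<open>A\<close> annihilates
    \<open>sqrt_op \<rho> e\<close>. Otherwise \<open>l = 4 * En / t\<close> turns
    \<open>l * b \<le> En\<close> into \<open>b \<le> t / 4\<close>.\<close>
  proof (cases "En = 0")
    case True
    then have "tail l = 0"
      unfolding tail_def using tail_eq_zero[OF _ zero] En l by (intro infsum_0) simp
    then show ?thesis by simp
  next
    case False
    then have l0: "0 < l" using l En0 t0 by simp
    have "tail l < \<infinity>" using split[of l] tr_fin by auto
    then obtain b where b: "0 \<le> b" "tail l = ennreal b"
      by (auto simp: less_top_ennreal)
    have "ennreal (l * b) \<le> ennreal En"
      using tail[of l] l0 b En by (simp add: ennreal_mult)
    then have "l * b \<le> En" using En0 by (simp add: ennreal_le_iff)
    then have "b \<le> t / 4" using t0 False En0 by (simp add: l field_simps)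
    then show ?thesis using b by (simp add: ennreal_leI)
  qed
  define K where "K = onorm \<rho>"
  have bl: "bounded_linear \<rho>" using \<rho> by (simp add: positive_bounded_iff)
  have K: "0 < K"
    using nz onorm_pos_lt[OF bl] by (auto simp: K_def)
  obtain n where n: "0 \<le> n" "nu (spec_proj excl_zero E l) \<Omega> = ennreal n"
    using nu[of l] by (auto simp: less_top_ennreal)
  have "ennreal t \<le> ennreal (K * n) + ennreal (t / 4)"
    using add_mono[OF head[of l] tail_le] n K by (simp add: split[of l, unfolded t] K_def[symmetric] ennreal_mult)
  then have "ennreal t \<le> ennreal (K * n + t / 4)"
    using n K t0 by simp
  then have "t \<le> K * n + t / 4"
    using n K t0 by (subst (asm) ennreal_le_iff) auto
  then have "t / (4 * K) \<le> n"
    using t0 K by (simp add: field_simps)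
  then show ?thesis
    using K t0 n by (simp add: F_local_def l_def[symmetric] t K_def[symmetric] divide_ennreal ennreal_leI)
qed

text \<open>A unit vector of \<open>V\<close> has energy at most \<open>l\<close>, so its part
  beyond the threshold \<open>4 * l\<close> has squared norm at most one quarter. The projection
  thus keeps at least a quarter of each of \<open>dim V\<close> orthonormal vectors, and what it
  keeps sums to at most the local trace.\<close>

lemma F_dim_le:
  fixes E :: "real set \<Rightarrow> ('x::sigma_finite_space, 'h::separable_hilbert) L2 \<Rightarrow> ('x, 'h) L2"
  assumes spec: "positive_spectral E D A" and \<Omega>: "\<Omega> \<in> sets \<mu>"
  shows "F_dim excl_zero D A E \<Omega> l \<le> 4 * F_local excl_zero E \<Omega> (4 * l)"
  unfolding F_dim_def
proof (rule SUP_least, clarify)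
  interpret positive_spectral E D A by fact
  fix B :: "('x, 'h) L2 set"
  let ?V = "complex_vector.span B"
  assume B: "finite B" and supp: "\<forall>f\<in>?V. vanishes_outside \<Omega> f"
    and en: "\<forall>f\<in>?V. f \<in> fcalc_dom E sqrt \<and> (norm (fcalc E sqrt f))\<^sup>2 \<le> l * (norm f)\<^sup>2"
    and perp: "excl_zero \<longrightarrow> (\<forall>f\<in>?V. \<forall>g\<in>null_space D A. cinner g f = 0)"
  obtain W where W: "finite W" "W \<subseteq> ?V" "orthonormal W" "card W = complex_vector.dim ?V"
    using orthonormal_in_span_exists[OF B order.refl] by blast
  let ?P = "spec_proj excl_zero E (4 * l)"
  have ge: "1 \<le> 4 * (norm (?P v))\<^sup>2" if v: "v \<in> W" for v
  proof -
    have norm: "norm v = 1" using W(3) v by (auto simp: orthonormal_def)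
    have vV: "v \<in> ?V" using v W(2) by auto
    have dom: "v \<in> fcalc_dom E sqrt" and le: "(norm (fcalc E sqrt v))\<^sup>2 \<le> l"
      using en vV norm by auto
    have zero: "E {0} v = 0" if excl_zero
      using perp vV that by (intro E_zero_eq_zero) auto
    \<comment> \<open>A unit vector in \<open>W\<close> forces this; for negative \<open>l\<close>
      the set \<open>W\<close> is empty, and the dimension and the sum over \<open>W\<close> are
      both zero.\<close>
    have l0: "0 \<le> l" using le zero_le_power2 order_trans by blast
    have "(norm (v - ?P v))\<^sup>2 \<le> 1 / 4"
    proof (cases "l = 0")
      case True
      then show ?thesis
        using spec_proj_complement_eq_zero[OF dom _ zero] le by simp
    next
      case False
      have "4 * l * (norm (v - ?P v))\<^sup>2 \<le> l"
        using order_trans[OF spec_proj_complement_norm_le[OF dom _ zero, of "4 * l"] le] l0 by simp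
      then have "l * (4 * (norm (v - ?P v))\<^sup>2) \<le> l * 1" by (simp add: mult_ac)
      then show ?thesis using l0 False by (simp add: mult_le_cancel_left_pos)
    qed
    moreover have "1 = (norm (?P v))\<^sup>2 + (norm (v - ?P v))\<^sup>2"
      using orthogonal_projection_pythagoras[OF orthogonal_projection_spec_proj, of v excl_zero "4 * l"]
      by (simp only: norm one_power2)
    ultimately show ?thesis by linarith
  qed
  have "of_nat (complex_vector.dim ?V) = (\<Sum>v\<in>W. ennreal 1)"
    by (simp add: W(4))
  also have "\<dots> \<le> (\<Sum>v\<in>W. ennreal (4 * (norm (?P v))\<^sup>2))"
    using ge by (intro sum_mono ennreal_leI)
  also have "\<dots> = 4 * (\<Sum>v\<in>W. ennreal ((norm (?P v))\<^sup>2))"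
    by (simp add: ennreal_mult sum_distrib_left del: sum_ennreal)
  also have "\<dots> \<le> 4 * nu ?P \<Omega>"
    using W(2) supp chi_vanishes_outside[OF _ \<Omega>]
    by (intro mult_left_mono sum_norm_projection_le_nu[OF W(1,3) \<Omega> _ orthogonal_projection_spec_proj]) auto
  finally show "of_nat (complex_vector.dim ?V) \<le> 4 * F_local excl_zero E \<Omega> (4 * l)"
    by (simp add: F_local_def)
qed

theorem corollary1p8:
  fixes D :: "('x::sigma_finite_space, 'h::separable_hilbert) L2 set"
    and A :: "('x, 'h) L2 \<Rightarrow> ('x, 'h) L2"
    and E :: "real set \<Rightarrow> ('x, 'h) L2 \<Rightarrow> ('x, 'h) L2"
    and excl_zero :: bool
  assumes "positive_self_adjoint D A"
    and "spectral_measure_of D A E"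
    and "\<forall>l. F_density excl_zero E l < \<infinity>"
  shows
    "(\<forall>\<rho> \<Omega>. positive_bounded \<rho> \<and> \<rho> \<noteq> (\<lambda>_. 0) \<and>
        (excl_zero \<longrightarrow> (\<forall>f\<in>null_space D A. \<rho> f = 0)) \<and>
        \<Omega> \<in> sets \<mu> \<and> emeasure \<mu> \<Omega> < \<infinity> \<and>
        \<rho> = chi \<Omega> \<circ> \<rho> \<circ> chi \<Omega> \<and> energy E \<rho> < \<infinity> \<longrightarrow>
        op_trace \<rho> / ennreal (4 * onorm \<rho>) \<le> F_local excl_zero E \<Omega> (4 * expectation_value E \<rho>) \<and>
        F_local excl_zero E \<Omega> (4 * expectation_value E \<rho>)
          \<le> emeasure \<mu> \<Omega> * F_density excl_zero E (4 * expectation_value E \<rho>)) \<and>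
     (\<forall>\<Omega> l. \<Omega> \<in> sets \<mu> \<and> emeasure \<mu> \<Omega> < \<infinity> \<longrightarrow>
        F_dim excl_zero D A E \<Omega> l \<le> 4 * emeasure \<mu> \<Omega> * F_density excl_zero E (4 * l))"
proof -
  have spec: "positive_spectral E D A"
    using assms(1,2)
    by (simp add: positive_spectral_def positive_spectral_axioms_def pvm_def spectral_measure_of_def)
  then interpret positive_spectral E D A .
  have local: "F_local excl_zero E \<Omega> l \<le> emeasure \<mu> \<Omega> * F_density excl_zero E l"
    if "\<Omega> \<in> sets \<mu>" for \<Omega> l
    unfolding F_local_def F_density_def
    by (rule nu_le_op_density[OF orthogonal_projection_spec_proj that])
  have "F_dim excl_zero D A E \<Omega> l \<le> 4 * emeasure \<mu> \<Omega> * F_density excl_zero E (4 * l)"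
    if "\<Omega> \<in> sets \<mu>" for \<Omega> l
    using order_trans[OF F_dim_le[OF spec that] mult_left_mono[OF local[OF that]]]
    by (simp add: mult.assoc)
  then show ?thesis
    using op_trace_le_F_local[OF spec assms(3)] local by blast
qed

end
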